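(* Let $k$ be a perfect field of characteristic $p>0$, let $R=k[x_1,\dots,x_n]$, let $R_s$ and $R_t$ be two copies of $R$, and let $F:R_s\to R_t$ be the Frobenius map $F(r)=r^p$. For a multi-index $\bar i=(i_1,\dots,i_n)$ with $0\le i_j<p$ for every $j$, put $e_{\bar i}=x_1^{i_1}\cdots x_n^{i_n}\in R_t$, and let $\overline{p-1}=(p-1,\dots,p-1)$. Then for every $R_t$-module $M$ and every $R_s$-module $N$ there is an $R_t$-linear isomorphism $$\mathrm{Hom}_{R_s}(F_*(M),N)\;\cong\;\mathrm{Hom}_{R_t}(M,F^*(N))$$ given by the following two mutually inverse maps. (1) From right to left: an $R_t$-linear map $g:M\to F^*(N)$, written uniquely as $g(m)=\sum_{\bar i}e_{\bar i}\otimes g_{\bar i}(m)$ with $R_s$-linear maps $g_{\bar i}:F_*(M)\to N$, is sent to $g_{\overline{p-1}}\in\mathrm{Hom}_{R_s}(F_*(M),N)$. (2) From left to right: $g\in\mathrm{Hom}_{R_s}(F_*(M),N)$ is sent to the map $m\mapsto\sum_{\bar i}e_{\bar i}\otimes g(e_{\overline{p-1}-\bar i}\,m)$. Here the sums run over all multi-indices $\bar i$ with $0\le i_j<p$ for every $j$.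
   Context: $F_*(M)$, for an $R_t$-module $M$, is the additive group of $M$ regarded as an $R_s$-module via $F$ (so $r\in R_s$ acts as multiplication by $r^p\in R_t$); it also retains its original $R_t$-module structure. $F^*(N)=R_t\otimes_{R_s}N$ for an $R_s$-module $N$, where $R_t$ is an $R_s$-module via $F$; it is an $R_t$-module through the left factor. $\mathrm{Hom}_{R_s}(F_*(M),N)$ is an $R_t$-module via $(rh)(m)=h(rm)$ for $r\in R_t$. Since $k$ is perfect, $R_t$ is a free $R_s$-module with basis the $p^n$ monomials $e_{\bar i}$, $0\le i_j<p$. Hence $F^*(N)=\bigoplus_{\bar i}(e_{\bar i}\otimes_{R_s}N)$ as $R_s$-modules, and every $R_s$-linear map $g:M\to F^*(N)$ (with $M$ regarded as the $R_s$-module $F_*(M)$) can be written uniquely as $g(m)=\sum_{\bar i}e_{\bar i}\otimes g_{\bar i}(m)$ with $R_s$-linear $g_{\bar i}:F_*(M)\to N$. The multi-index $\overline{p-1}-\bar i$ is $(p-1-i_1,\dots,p-1-i_n)$, and $e_{\overline{p-1}-\bar i}\,m$ denotes the action of $e_{\overline{p-1}-\bar i}\in R_t$ on $m\in M$. *)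

theory Defs
  imports
    "HOL-Algebra.Module"
    "HOL-Algebra.Free_Abelian_Groups"
    "HOL-Algebra.Generated_Groups"
    "HOL-Computational_Algebra.Primes"
begin

section \<open>Perfect fields and polynomial rings\<close>

definition perfect_field :: "'k::field itself \<Rightarrow> bool" where
  "perfect_field _ \<longleftrightarrow> CHAR('k) = 0 \<or> surj (\<lambda>a::'k. a ^ CHAR('k))"

text \<open>A polynomial is a finitely supported map from exponent vectors to coefficients, with the
  convolution product of \<^theory>\<open>HOL-Library.Poly_Mapping\<close>; the variables are indexed by the
  natural numbers, and the ring in \<open>n\<close> variables only uses those with index below \<open>n\<close>.\<close>

type_synonym 'k mpoly = "(nat \<Rightarrow>\<^sub>0 nat) \<Rightarrow>\<^sub>0 'k"

definition mpoly_ring :: "nat \<Rightarrow> 'k::field mpoly ring" where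
  "mpoly_ring n =
     \<lparr>carrier = {f. \<forall>m \<in> Poly_Mapping.keys f. Poly_Mapping.keys m \<subseteq> {..<n}},
      monoid.mult = (*), one = 1, ring.zero = 0, ring.add = (+)\<rparr>"

definition mpoly_var :: "nat \<Rightarrow> 'k::field mpoly" where
  "mpoly_var j = Poly_Mapping.single (Poly_Mapping.single j 1) 1"

definition frobenius :: "nat \<Rightarrow> ('a, 'c) ring_scheme \<Rightarrow> 'a \<Rightarrow> 'a" where
  "frobenius p R r = r [^]\<^bsub>R\<^esub> p"


section \<open>Homomorphisms of modules\<close>

text \<open>Module homomorphisms are taken to be extensional (\<^term>\<open>undefined\<close> outside the carrier), so
  that two of them are equal as soon as they agree on the carrier. The ring-multiplication
  fields \<open>mult\<close> and \<open>one\<close> that the record type of modules inherits play no role for modules and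
  are filled with \<^term>\<open>undefined\<close>.\<close>

definition module_homs ::
  "('a, 'c) ring_scheme \<Rightarrow> ('a, 'm) module \<Rightarrow> ('a, 'n) module \<Rightarrow> ('m \<Rightarrow> 'n) set" where
  "module_homs R M N =
     {h \<in> carrier M \<rightarrow>\<^sub>E carrier N.
        (\<forall>x \<in> carrier M. \<forall>y \<in> carrier M. h (x \<oplus>\<^bsub>M\<^esub> y) = h x \<oplus>\<^bsub>N\<^esub> h y) \<and>
        (\<forall>r \<in> carrier R. \<forall>x \<in> carrier M. h (r \<odot>\<^bsub>M\<^esub> x) = r \<odot>\<^bsub>N\<^esub> h x)}"

definition module_isos ::
  "('a, 'c) ring_scheme \<Rightarrow> ('a, 'm) module \<Rightarrow> ('a, 'n) module \<Rightarrow> ('m \<Rightarrow> 'n) set" where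
  "module_isos R M N = {h \<in> module_homs R M N. bij_betw h (carrier M) (carrier N)}"

definition hom_module ::
  "('a, 'c) ring_scheme \<Rightarrow> ('a, 'm) module \<Rightarrow> ('a, 'n) module \<Rightarrow> ('a, 'm \<Rightarrow> 'n) module" where
  "hom_module R M N =
     \<lparr>carrier = module_homs R M N, monoid.mult = undefined, one = undefined,
      ring.zero = (\<lambda>x \<in> carrier M. \<zero>\<^bsub>N\<^esub>),
      ring.add = (\<lambda>g h. \<lambda>x \<in> carrier M. g x \<oplus>\<^bsub>N\<^esub> h x),
      smult = (\<lambda>r h. \<lambda>x \<in> carrier M. r \<odot>\<^bsub>N\<^esub> h x)\<rparr>"


section \<open>Change of rings along a ring homomorphism \<open>f : A \<rightarrow> B\<close>\<close>

definition restrict_scalars :: "('a \<Rightarrow> 'b) \<Rightarrow> ('b, 'm) module \<Rightarrow> ('a, 'm) module" where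
  "restrict_scalars f M =
     \<lparr>carrier = carrier M, monoid.mult = undefined, one = undefined,
      ring.zero = \<zero>\<^bsub>M\<^esub>, ring.add = (\<oplus>\<^bsub>M\<^esub>), smult = (\<lambda>a x. f a \<odot>\<^bsub>M\<^esub> x)\<rparr>"

text \<open>The abelian group of \<open>A\<close>-linear maps from the restriction of the \<open>B\<close>-module \<open>M\<close> to the
  \<open>A\<close>-module \<open>N\<close>, with \<open>B\<close> acting through the source.\<close>

definition hom_from_restriction ::
  "('a, 'c) ring_scheme \<Rightarrow> ('a \<Rightarrow> 'b) \<Rightarrow> ('b, 'm) module \<Rightarrow> ('a, 'n) module \<Rightarrow>
   ('b, 'm \<Rightarrow> 'n) module" where
  "hom_from_restriction A f M N =
     \<lparr>carrier = module_homs A (restrict_scalars f M) N,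
      monoid.mult = undefined, one = undefined,
      ring.zero = (\<lambda>x \<in> carrier M. \<zero>\<^bsub>N\<^esub>),
      ring.add = (\<lambda>g h. \<lambda>x \<in> carrier M. g x \<oplus>\<^bsub>N\<^esub> h x),
      smult = (\<lambda>r h. \<lambda>x \<in> carrier M. h (r \<odot>\<^bsub>M\<^esub> x))\<rparr>"

text \<open>The tensor product of \<open>B\<close> and \<open>N\<close> over \<open>A\<close> is the quotient of the free abelian group on
  pairs \<open>(b, x)\<close> by the subgroup generated by the relations of biadditivity and \<open>A\<close>-balancedness.
  The library writes free abelian groups and their quotients multiplicatively, so the addition
  of the tensor product is the set multiplication of cosets.\<close>

definition tensor_relators ::
  "('a, 'c) ring_scheme \<Rightarrow> ('b, 'd) ring_scheme \<Rightarrow> ('a \<Rightarrow> 'b) \<Rightarrow> ('a, 'n) module \<Rightarrow>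
   ('b \<times> 'n \<Rightarrow>\<^sub>0 int) set" where
  "tensor_relators A B f N =
     {frag_of (b \<oplus>\<^bsub>B\<^esub> c, x) - frag_of (b, x) - frag_of (c, x) | b c x.
        b \<in> carrier B \<and> c \<in> carrier B \<and> x \<in> carrier N} \<union>
     {frag_of (b, x \<oplus>\<^bsub>N\<^esub> y) - frag_of (b, x) - frag_of (b, y) | b x y.
        b \<in> carrier B \<and> x \<in> carrier N \<and> y \<in> carrier N} \<union>
     {frag_of (f a \<otimes>\<^bsub>B\<^esub> b, x) - frag_of (b, a \<odot>\<^bsub>N\<^esub> x) | a b x.
        a \<in> carrier A \<and> b \<in> carrier B \<and> x \<in> carrier N}"

definition tensor_free ::
  "('b, 'd) ring_scheme \<Rightarrow> ('a, 'n) module \<Rightarrow> ('b \<times> 'n \<Rightarrow>\<^sub>0 int) monoid" where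
  "tensor_free B N = free_Abelian_group (carrier B \<times> carrier N)"

definition tensor_kernel ::
  "('a, 'c) ring_scheme \<Rightarrow> ('b, 'd) ring_scheme \<Rightarrow> ('a \<Rightarrow> 'b) \<Rightarrow> ('a, 'n) module \<Rightarrow>
   ('b \<times> 'n \<Rightarrow>\<^sub>0 int) set" where
  "tensor_kernel A B f N = generate (tensor_free B N) (tensor_relators A B f N)"

definition pure_tensor ::
  "('a, 'c) ring_scheme \<Rightarrow> ('b, 'd) ring_scheme \<Rightarrow> ('a \<Rightarrow> 'b) \<Rightarrow> ('a, 'n) module \<Rightarrow>
   'b \<Rightarrow> 'n \<Rightarrow> ('b \<times> 'n \<Rightarrow>\<^sub>0 int) set" where
  "pure_tensor A B f N b x = tensor_kernel A B f N #>\<^bsub>tensor_free B N\<^esub> frag_of (b, x)"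

text \<open>Multiplication by \<open>r\<close> on the left factor, on representatives: it is the additive map sending
  the generator \<open>(b, x)\<close> to \<open>(r b, x)\<close>.\<close>

definition tensor_act ::
  "('b, 'd) ring_scheme \<Rightarrow> 'b \<Rightarrow> ('b \<times> 'n \<Rightarrow>\<^sub>0 int) \<Rightarrow> ('b \<times> 'n \<Rightarrow>\<^sub>0 int)" where
  "tensor_act B r = frag_extend (\<lambda>(b, x). frag_of (r \<otimes>\<^bsub>B\<^esub> b, x))"

text \<open>In the scalar multiplication below all the cosets in the union coincide.\<close>

definition extend_scalars ::
  "('a, 'c) ring_scheme \<Rightarrow> ('b, 'd) ring_scheme \<Rightarrow> ('a \<Rightarrow> 'b) \<Rightarrow> ('a, 'n) module \<Rightarrow>
   ('b, ('b \<times> 'n \<Rightarrow>\<^sub>0 int) set) module" where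
  "extend_scalars A B f N =
     (let G = tensor_free B N; H = tensor_kernel A B f N in
      \<lparr>carrier = carrier (G Mod H), monoid.mult = undefined, one = undefined,
       ring.zero = \<one>\<^bsub>G Mod H\<^esub>, ring.add = (\<otimes>\<^bsub>G Mod H\<^esub>),
       smult = (\<lambda>r X. \<Union>u \<in> X. H #>\<^bsub>G\<^esub> tensor_act B r u)\<rparr>)"


section \<open>The Frobenius functors on a polynomial ring\<close>

text \<open>Both copies of the polynomial ring are \<^term>\<open>mpoly_ring n\<close>.\<close>

definition Frob_push :: "nat \<Rightarrow> nat \<Rightarrow> ('k::field mpoly, 'm) module \<Rightarrow> ('k mpoly, 'm) module" where
  "Frob_push p n M = restrict_scalars (frobenius p (mpoly_ring n)) M"

definition Frob_pull ::
  "nat \<Rightarrow> nat \<Rightarrow> ('k::field mpoly, 'n) module \<Rightarrow>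
   ('k mpoly, ('k mpoly \<times> 'n \<Rightarrow>\<^sub>0 int) set) module" where
  "Frob_pull p n N = extend_scalars (mpoly_ring n) (mpoly_ring n) (frobenius p (mpoly_ring n)) N"

definition Frob_tensor ::
  "nat \<Rightarrow> nat \<Rightarrow> ('k::field mpoly, 'n) module \<Rightarrow> 'k mpoly \<Rightarrow> 'n \<Rightarrow>
   ('k mpoly \<times> 'n \<Rightarrow>\<^sub>0 int) set" where
  "Frob_tensor p n N = pure_tensor (mpoly_ring n) (mpoly_ring n) (frobenius p (mpoly_ring n)) N"

definition Hom_push ::
  "nat \<Rightarrow> nat \<Rightarrow> ('k::field mpoly, 'm) module \<Rightarrow> ('k mpoly, 'n) module \<Rightarrow>
   ('k mpoly, 'm \<Rightarrow> 'n) module" where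
  "Hom_push p n M N = hom_from_restriction (mpoly_ring n) (frobenius p (mpoly_ring n)) M N"

definition Hom_pull ::
  "nat \<Rightarrow> nat \<Rightarrow> ('k::field mpoly, 'm) module \<Rightarrow> ('k mpoly, 'n) module \<Rightarrow>
   ('k mpoly, 'm \<Rightarrow> ('k mpoly \<times> 'n \<Rightarrow>\<^sub>0 int) set) module" where
  "Hom_pull p n M N = hom_module (mpoly_ring n) M (Frob_pull p n N)"

definition multi_indices :: "nat \<Rightarrow> nat \<Rightarrow> (nat \<Rightarrow> nat) set" where
  "multi_indices p n = {..<n} \<rightarrow>\<^sub>E {..<p}"

definition monomial_basis :: "nat \<Rightarrow> (nat \<Rightarrow> nat) \<Rightarrow> 'k::field mpoly" where
  "monomial_basis n i = (\<Prod>j<n. mpoly_var j ^ i j)"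

definition top_index :: "nat \<Rightarrow> nat \<Rightarrow> nat \<Rightarrow> nat" where
  "top_index p n = (\<lambda>j \<in> {..<n}. p - 1)"

definition complement_index :: "nat \<Rightarrow> nat \<Rightarrow> (nat \<Rightarrow> nat) \<Rightarrow> nat \<Rightarrow> nat" where
  "complement_index p n i = (\<lambda>j \<in> {..<n}. p - 1 - i j)"

definition is_expansion ::
  "nat \<Rightarrow> nat \<Rightarrow> ('k::field mpoly, 'm) module \<Rightarrow> ('k mpoly, 'n) module \<Rightarrow>
   ('m \<Rightarrow> ('k mpoly \<times> 'n \<Rightarrow>\<^sub>0 int) set) \<Rightarrow> ((nat \<Rightarrow> nat) \<Rightarrow> 'm \<Rightarrow> 'n) \<Rightarrow> bool" where
  "is_expansion p n M N g c \<longleftrightarrow>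
     c \<in> multi_indices p n \<rightarrow>\<^sub>E module_homs (mpoly_ring n) (Frob_push p n M) N \<and>
     (\<forall>m \<in> carrier M. g m =
        (\<Oplus>\<^bsub>Frob_pull p n N\<^esub>i \<in> multi_indices p n. Frob_tensor p n N (monomial_basis n i) (c i m)))"

definition pull_to_push ::
  "nat \<Rightarrow> nat \<Rightarrow> ('k::field mpoly, 'm) module \<Rightarrow> ('k mpoly, 'n) module \<Rightarrow>
   ('m \<Rightarrow> ('k mpoly \<times> 'n \<Rightarrow>\<^sub>0 int) set) \<Rightarrow> ('m \<Rightarrow> 'n)" where
  "pull_to_push p n M N =
     (\<lambda>g \<in> carrier (Hom_pull p n M N). (THE c. is_expansion p n M N g c) (top_index p n))"

definition push_to_pull ::
  "nat \<Rightarrow> nat \<Rightarrow> ('k::field mpoly, 'm) module \<Rightarrow> ('k mpoly, 'n) module \<Rightarrow>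
   ('m \<Rightarrow> 'n) \<Rightarrow> ('m \<Rightarrow> ('k mpoly \<times> 'n \<Rightarrow>\<^sub>0 int) set)" where
  "push_to_pull p n M N =
     (\<lambda>g \<in> carrier (Hom_push p n M N). \<lambda>m \<in> carrier M.
        \<Oplus>\<^bsub>Frob_pull p n N\<^esub>i \<in> multi_indices p n.
          Frob_tensor p n N (monomial_basis n i)
            (g (monomial_basis n (complement_index p n i) \<odot>\<^bsub>M\<^esub> m)))"


section \<open>The constructions above are modules\<close>

lemma cring_mpoly_ring: "cring (mpoly_ring n :: 'k::field mpoly ring)"
proof -
  let ?C = "{f :: 'k mpoly. \<forall>m \<in> Poly_Mapping.keys f. Poly_Mapping.keys m \<subseteq> {..<n}}"
  have a: "f + g \<in> ?C" if "f \<in> ?C" "g \<in> ?C" for f g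
    using that Poly_Mapping.keys_add[of f g] by blast
  have u: "- f \<in> ?C" if "f \<in> ?C" for f using that by simp
  have m: "f * g \<in> ?C" if "f \<in> ?C" "g \<in> ?C" for f g
  proof clarify
    fix k x assume "k \<in> Poly_Mapping.keys (f * g)" and x: "x \<in> Poly_Mapping.keys k"
    then obtain a b where "k = a + b" "a \<in> Poly_Mapping.keys f" "b \<in> Poly_Mapping.keys g"
      using keys_mult[of f g] by auto
    then show "x < n" using that x Poly_Mapping.keys_add[of a b] by blast
  qed
  have 1: "1 \<in> ?C" by simp
  show ?thesis
    apply (rule cringI)
      apply (rule abelian_groupI)
           apply (simp_all only: mpoly_ring_def partial_object.simps monoid.simps ring.simps)
           apply (rule a; assumption)
          apply simp
         apply (simp add: add.assoc)
        apply (simp add: add.commute)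
       apply simp
     apply (rule_tac x="- x" in bexI, simp, erule u)
    apply (rule comm_monoidI)
        apply (simp_all only: mpoly_ring_def partial_object.simps monoid.simps ring.simps)
        apply (rule m; assumption)
       apply (rule 1)
      apply (simp_all add: mult.assoc mult.commute distrib_left)
    done
qed

lemma module_hom_module:
  assumes M: "module R M" and N: "module R N"
  shows "module R (hom_module R M N)"
proof -
  interpret M: module R M by fact
  interpret N: module R N by fact
  have "\<exists>y\<in>module_homs R M N. (\<lambda>z\<in>carrier M. y z \<oplus>\<^bsub>N\<^esub> x z) = (\<lambda>x\<in>carrier M. \<zero>\<^bsub>N\<^esub>)" if x: "x \<in> module_homs R M N" for x
    apply (rule bexI[where x="\<lambda>z\<in>carrier M. \<ominus>\<^bsub>N\<^esub> x z"])
    using x by (auto simp: module_homs_def PiE_iff fun_eq_iff N.M.l_neg N.smult_r_minus N.M.minus_add intro!: N.M.minus_closed)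
  then show ?thesis
    apply (intro moduleI abelian_groupI)
    apply (simp_all add: hom_module_def M.R.cring_axioms M.is_cring)
    apply (auto simp: module_homs_def PiE_iff fun_eq_iff extensional_def N.smult_l_distr N.smult_r_distr N.smult_assoc1 N.M.a_ac M.R.m_comm simp flip: N.smult_assoc1)
    done
qed

lemma module_hom_from_restriction:
  assumes M: "module B M" and N: "module A N" and f: "f \<in> carrier A \<rightarrow> carrier B"
  shows "module B (hom_from_restriction A f M N)"
proof -
  interpret M: module B M by fact
  interpret N: module A N by fact
  have ff: "f a \<in> carrier B" if "a \<in> carrier A" for a using f that by auto
  have c: "f a \<odot>\<^bsub>M\<^esub> (r \<odot>\<^bsub>M\<^esub> x) = r \<odot>\<^bsub>M\<^esub> (f a \<odot>\<^bsub>M\<^esub> x)" if "a \<in> carrier A" "r \<in> carrier B" "x \<in> carrier M" for a r x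
    using that ff by (simp add: M.R.m_comm flip: M.smult_assoc1)
  have inv: "\<exists>y\<in>module_homs A (restrict_scalars f M) N. (\<lambda>z\<in>carrier M. y z \<oplus>\<^bsub>N\<^esub> x z) = (\<lambda>x\<in>carrier M. \<zero>\<^bsub>N\<^esub>)" if x: "x \<in> module_homs A (restrict_scalars f M) N" for x
    apply (rule bexI[where x="\<lambda>z\<in>carrier M. \<ominus>\<^bsub>N\<^esub> x z"])
    using x ff by (auto simp: module_homs_def restrict_scalars_def PiE_iff fun_eq_iff N.M.l_neg N.smult_r_minus N.M.minus_add intro!: N.M.minus_closed)
  have s: "(\<lambda>x\<in>carrier M. h (r \<odot>\<^bsub>M\<^esub> x)) \<in> module_homs A (restrict_scalars f M) N"
    if "r \<in> carrier B" "h \<in> module_homs A (restrict_scalars f M) N" for r h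
    using that ff by (auto simp: module_homs_def restrict_scalars_def PiE_iff M.smult_r_distr c [symmetric])
  show ?thesis
    apply (intro moduleI abelian_groupI)
    apply (simp_all add: hom_from_restriction_def M.is_cring inv s)
    using ff by (auto simp: module_homs_def restrict_scalars_def PiE_iff fun_eq_iff extensional_def N.smult_l_distr N.smult_r_distr N.smult_assoc1 M.smult_l_distr M.smult_r_distr M.smult_assoc1 N.M.a_ac M.R.m_comm simp flip: M.smult_assoc1)
qed


lemma module_extend_scalars:
  fixes f :: "'a \<Rightarrow> 'b"
  assumes B: "cring B" and N: "module A N" and f: "f \<in> carrier A \<rightarrow> carrier B"
  shows "module B (extend_scalars A B f N)"
proof -
  interpret B: cring B by fact
  interpret N: module A N by fact
  define G where "G = tensor_free B N"
  define H where "H = tensor_kernel A B f N"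
  let ?S = "carrier B \<times> carrier N"
  let ?T = "tensor_relators A B f N"
  have ff: "f a \<in> carrier B" if "a \<in> carrier A" for a using f that by auto
  interpret G: comm_group G unfolding G_def tensor_free_def by (rule abelian_free_Abelian_group)
  have cG: "u \<in> carrier G \<longleftrightarrow> Poly_Mapping.keys u \<subseteq> ?S" for u by (simp add: G_def tensor_free_def)
  have mG: "u \<otimes>\<^bsub>G\<^esub> v = u + v" for u v by (simp add: G_def tensor_free_def)
  have oG: "\<one>\<^bsub>G\<^esub> = 0" by (simp add: G_def tensor_free_def)
  have iG: "inv\<^bsub>G\<^esub> u = - u" if "u \<in> carrier G" for u using that by (simp add: G_def tensor_free_def)
  have diffG: "u - v \<in> carrier G" if "u \<in> carrier G" "v \<in> carrier G" for u v
    using that Poly_Mapping.keys_diff[of u v] unfolding cG by blast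
  have frag: "frag_of (b,x) \<in> carrier G" if "b \<in> carrier B" "x \<in> carrier N" for b x
    using that by (simp add: cG)
  have TG: "?T \<subseteq> carrier G"
    unfolding tensor_relators_def by (auto intro!: diffG frag simp: ff)
  have HG: "subgroup H G" unfolding H_def tensor_kernel_def G_def [symmetric]
    using TG by (rule G.generate_is_subgroup)
  interpret H: subgroup H G by fact
  interpret HN: normal H G by (simp add: G.normal_iff_subgroup HG)
  interpret Q: comm_group "G Mod H" by (rule G.abelian_FactGroup[OF HG])
  have act_add: "tensor_act B r (u + v) = tensor_act B r u + tensor_act B r v" for r u v
    by (simp add: tensor_act_def frag_extend_add)
  have act_diff: "tensor_act B r (u - v) = tensor_act B r u - tensor_act B r v" for r u v
    by (simp add: tensor_act_def frag_extend_diff)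
  have act_of: "tensor_act B r (frag_of (b,x)) = frag_of (r \<otimes>\<^bsub>B\<^esub> b, x)" for r b x
    by (simp add: tensor_act_def)
  have act_uminus: "tensor_act B r (- u) = - tensor_act B r u" for r u
    by (simp add: tensor_act_def frag_extend_minus)
  have act_G: "tensor_act B r u \<in> carrier G" if "r \<in> carrier B" "u \<in> carrier G" for r u
  proof -
    have "Poly_Mapping.keys u \<subseteq> ?S" using that cG by simp
    then show ?thesis
    proof (induction u rule: frag_induction)
      case zero show ?case by (simp add: cG tensor_act_def)
    next
      case (one x) then show ?case using that by (cases x) (auto simp: act_of intro!: frag)
    next
      case (diff a b) then show ?case by (simp add: act_diff \<open>tensor_act B r a \<in> carrier G\<close> \<open>tensor_act B r b \<in> carrier G\<close> diffG)
    qed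
  qed
  have T1: "frag_of (b \<oplus>\<^bsub>B\<^esub> c, x) - frag_of (b, x) - frag_of (c, x) \<in> ?T"
    if "b \<in> carrier B" "c \<in> carrier B" "x \<in> carrier N" for b c x
    unfolding tensor_relators_def by ((rule UnI1)+, rule CollectI, (rule exI)+, rule conjI, rule refl, intro conjI that)
  have T2: "frag_of (b, x \<oplus>\<^bsub>N\<^esub> y) - frag_of (b, x) - frag_of (b, y) \<in> ?T"
    if "b \<in> carrier B" "x \<in> carrier N" "y \<in> carrier N" for b x y
    unfolding tensor_relators_def
    by (rule UnI1, rule UnI2, rule CollectI, (rule exI)+, rule conjI, rule refl, intro conjI that)
  have T3: "frag_of (f a \<otimes>\<^bsub>B\<^esub> b, x) - frag_of (b, a \<odot>\<^bsub>N\<^esub> x) \<in> ?T"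
    if "a \<in> carrier A" "b \<in> carrier B" "x \<in> carrier N" for a b x
    unfolding tensor_relators_def by (rule UnI2, rule CollectI, (rule exI)+, rule conjI, rule refl, intro conjI that)
  have act_T: "tensor_act B r u \<in> ?T" if r: "r \<in> carrier B" and "u \<in> ?T" for r u
  proof -
    from that(2) consider 
       (1) b c x where "b \<in> carrier B" "c \<in> carrier B" "x \<in> carrier N" "u = frag_of (b \<oplus>\<^bsub>B\<^esub> c, x) - frag_of (b, x) - frag_of (c, x)"
     | (2) b x y where "b \<in> carrier B" "x \<in> carrier N" "y \<in> carrier N" "u = frag_of (b, x \<oplus>\<^bsub>N\<^esub> y) - frag_of (b, x) - frag_of (b, y)"
     | (3) a b x where "a \<in> carrier A" "b \<in> carrier B" "x \<in> carrier N" "u = frag_of (f a \<otimes>\<^bsub>B\<^esub> b, x) - frag_of (b, a \<odot>\<^bsub>N\<^esub> x)"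
      unfolding tensor_relators_def
      apply (elim UnE CollectE exE conjE)
        apply (rule that(1); assumption)
       apply (rule that(2); assumption)
      apply (rule that(3); assumption)
      done
    then show ?thesis
    proof cases
      case 1
      have "tensor_act B r u = frag_of (r \<otimes>\<^bsub>B\<^esub> b \<oplus>\<^bsub>B\<^esub> r \<otimes>\<^bsub>B\<^esub> c, x) - frag_of (r \<otimes>\<^bsub>B\<^esub> b, x) - frag_of (r \<otimes>\<^bsub>B\<^esub> c, x)"
        using 1 r by (simp add: act_diff act_of B.r_distr)
      then show ?thesis using T1 1 r by simp
    next
      case 2
      have "tensor_act B r u = frag_of (r \<otimes>\<^bsub>B\<^esub> b, x \<oplus>\<^bsub>N\<^esub> y) - frag_of (r \<otimes>\<^bsub>B\<^esub> b, x) - frag_of (r \<otimes>\<^bsub>B\<^esub> b, y)"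
        using 2 r by (simp add: act_diff act_of)
      then show ?thesis using T2 2 r by simp
    next
      case 3
      have "tensor_act B r u = frag_of (f a \<otimes>\<^bsub>B\<^esub> (r \<otimes>\<^bsub>B\<^esub> b), x) - frag_of (r \<otimes>\<^bsub>B\<^esub> b, a \<odot>\<^bsub>N\<^esub> x)"
        using 3 r ff by (simp add: act_diff act_of B.m_lcomm)
      then show ?thesis using T3 3 r by simp
    qed
  qed
  have act_H: "tensor_act B r u \<in> H" if r: "r \<in> carrier B" and "u \<in> H" for r u
  proof -
    from that(2) have "u \<in> generate G ?T" by (simp add: H_def tensor_kernel_def G_def)
    then show ?thesis
    proof (induction u rule: generate.induct)
      case one then show ?case using H.one_closed by (simp add: oG tensor_act_def)
    next
      case (incl h)
      then show ?case using act_T[OF r] by (simp add: H_def tensor_kernel_def generate.incl)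
    next
      case (inv h)
      then have hG: "h \<in> carrier G" using TG by blast
      have "tensor_act B r h \<in> H" using inv act_T[OF r] by (simp add: H_def tensor_kernel_def generate.incl)
      then have "inv\<^bsub>G\<^esub> (tensor_act B r h) \<in> H" by simp
      then show ?case using iG hG act_G r by (simp add: act_uminus)
    next
      case (eng a b) then show ?case using H.m_closed by (simp add: mG act_add)
    qed
  qed
  let ?E = "extend_scalars A B f N"
  have E: "carrier ?E = carrier (G Mod H)" "\<zero>\<^bsub>?E\<^esub> = \<one>\<^bsub>G Mod H\<^esub>" "X \<oplus>\<^bsub>?E\<^esub> Y = X \<otimes>\<^bsub>G Mod H\<^esub> Y"
     "r \<odot>\<^bsub>?E\<^esub> X = (\<Union>u \<in> X. H #>\<^bsub>G\<^esub> tensor_act B r u)" for X Y r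
    by (simp_all add: extend_scalars_def Let_def G_def H_def)
  have cE: "X \<in> carrier ?E \<longleftrightarrow> (\<exists>u\<in>carrier G. X = H #>\<^bsub>G\<^esub> u)" for X by (auto simp: E carrier_FactGroup)
  have sm: "r \<odot>\<^bsub>?E\<^esub> (H #>\<^bsub>G\<^esub> u) = H #>\<^bsub>G\<^esub> tensor_act B r u" if r: "r \<in> carrier B" and u: "u \<in> carrier G" for r u
  proof -
    have "H #>\<^bsub>G\<^esub> tensor_act B r v = H #>\<^bsub>G\<^esub> tensor_act B r u" if "v \<in> H #>\<^bsub>G\<^esub> u" for v
    proof -
      from that obtain h where h: "h \<in> H" "v = h + u" by (auto simp: r_coset_def mG)
      then have "tensor_act B r v = tensor_act B r h \<otimes>\<^bsub>G\<^esub> tensor_act B r u" by (simp add: mG act_add)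
      then have "tensor_act B r v \<in> H #>\<^bsub>G\<^esub> tensor_act B r u" using act_H[OF r h(1)] by (auto simp: r_coset_def)
      then show ?thesis using G.repr_independence[OF _ act_G[OF r u] HG] by simp
    qed
    moreover have "u \<in> H #>\<^bsub>G\<^esub> u" using G.rcos_self[OF u HG] .
    ultimately show ?thesis unfolding E by blast
  qed
  have ad: "(H #>\<^bsub>G\<^esub> u) \<oplus>\<^bsub>?E\<^esub> (H #>\<^bsub>G\<^esub> v) = H #>\<^bsub>G\<^esub> (u + v)" if "u \<in> carrier G" "v \<in> carrier G" for u v
    using that by (simp add: E HN.rcos_sum mG)
  have distr: "H #>\<^bsub>G\<^esub> tensor_act B (r \<oplus>\<^bsub>B\<^esub> s) u = H #>\<^bsub>G\<^esub> (tensor_act B r u + tensor_act B s u)"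
    if r: "r \<in> carrier B" and s: "s \<in> carrier B" and u: "u \<in> carrier G" for r s u
  proof -
    have "tensor_act B (r \<oplus>\<^bsub>B\<^esub> s) u - (tensor_act B r u + tensor_act B s u) \<in> H" using u[unfolded cG]
    proof (induction u rule: frag_induction)
      case zero then show ?case using H.one_closed by (simp add: oG tensor_act_def)
    next
      case (one y)
      obtain b x where y: "y = (b,x)" "b \<in> carrier B" "x \<in> carrier N" using one by auto
      have "frag_of (r \<otimes>\<^bsub>B\<^esub> b \<oplus>\<^bsub>B\<^esub> s \<otimes>\<^bsub>B\<^esub> b, x) - frag_of (r \<otimes>\<^bsub>B\<^esub> b, x) - frag_of (s \<otimes>\<^bsub>B\<^esub> b, x) \<in> ?T"
        using T1 y r s by simp
      then show ?case using y r s by (simp add: act_of B.l_distr H_def tensor_kernel_def generate.incl diff_diff_eq)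
    next
      case (diff a b)
      let ?d = "\<lambda>u. tensor_act B (r \<oplus>\<^bsub>B\<^esub> s) u - (tensor_act B r u + tensor_act B s u)"
      have "?d a \<otimes>\<^bsub>G\<^esub> inv\<^bsub>G\<^esub> ?d b \<in> H" using diff by simp
      then have "?d a - ?d b \<in> H" using diff H.mem_carrier iG
        by (simp add: mG algebra_simps)
      moreover have "?d a - ?d b = ?d (a - b)" by (simp add: act_diff)
      ultimately show ?case by simp
    qed
    moreover have "tensor_act B (r \<oplus>\<^bsub>B\<^esub> s) u =
        (tensor_act B (r \<oplus>\<^bsub>B\<^esub> s) u - (tensor_act B r u + tensor_act B s u)) \<otimes>\<^bsub>G\<^esub>
        (tensor_act B r u + tensor_act B s u)" unfolding mG by simp
    ultimately have 1: "tensor_act B (r \<oplus>\<^bsub>B\<^esub> s) u \<in> H #>\<^bsub>G\<^esub> (tensor_act B r u + tensor_act B s u)"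
      unfolding r_coset_def by blast
    have c: "tensor_act B r u + tensor_act B s u \<in> carrier G"
      using G.m_closed[OF act_G[OF r u] act_G[OF s u]] unfolding mG .
    show ?thesis using G.repr_independence[OF 1 c HG] by simp
  qed
  have assoc: "tensor_act B (r \<otimes>\<^bsub>B\<^esub> s) u = tensor_act B r (tensor_act B s u)" 
    if r: "r \<in> carrier B" and s: "s \<in> carrier B" and u: "u \<in> carrier G" for r s u
    using u[unfolded cG]
    by (induction u rule: frag_induction) (use r s in \<open>auto simp: act_of act_diff B.m_assoc, simp add: tensor_act_def\<close>)
  have one: "tensor_act B \<one>\<^bsub>B\<^esub> u = u" if u: "u \<in> carrier G" for u
    using u[unfolded cG]
    by (induction u rule: frag_induction) (auto simp: act_of act_diff, simp add: tensor_act_def)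
  have ab: "abelian_group ?E"
  proof (rule abelian_groupI, unfold E)
    fix x assume "x \<in> carrier (G Mod H)"
    then show "\<exists>y\<in>carrier (G Mod H). y \<otimes>\<^bsub>G Mod H\<^esub> x = \<one>\<^bsub>G Mod H\<^esub>"
      by (intro bexI[where x = "inv\<^bsub>G Mod H\<^esub> x"] Q.l_inv Q.inv_closed)
  qed (fact Q.m_closed Q.one_closed Q.m_assoc Q.m_comm Q.l_one)+
  have add: "u + v \<in> carrier G" if "u \<in> carrier G" "v \<in> carrier G" for u v using G.m_closed[OF that] unfolding mG .
  show ?thesis
    apply (rule moduleI[OF B ab])
    unfolding cE
    by (auto simp: sm ad act_G distr assoc one add act_add intro!: act_G)
qed

lemma frobenius_closed: "cring R \<Longrightarrow> frobenius p R \<in> carrier R \<rightarrow> carrier R"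
  by (auto simp: frobenius_def cring_def ring_def intro!: monoid.nat_pow_closed)

lemma module_Frob_pull:
  "Module.module (mpoly_ring n) N \<Longrightarrow> Module.module (mpoly_ring n) (Frob_pull p n N)"
  unfolding Frob_pull_def
  by (intro module_extend_scalars frobenius_closed cring_mpoly_ring)

lemma module_Hom_push:
  "Module.module (mpoly_ring n) M \<Longrightarrow> Module.module (mpoly_ring n) N \<Longrightarrow>
   Module.module (mpoly_ring n) (Hom_push p n M N)"
  unfolding Hom_push_def
  by (intro module_hom_from_restriction frobenius_closed cring_mpoly_ring)

lemma module_Hom_pull:
  "Module.module (mpoly_ring n) M \<Longrightarrow> Module.module (mpoly_ring n) N \<Longrightarrow>
   Module.module (mpoly_ring n) (Hom_pull p n M N)"
  unfolding Hom_pull_def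
  by (intro module_hom_module module_Frob_pull)

end

theory Submission
  imports Defs
begin

text \<open>Since \<open>k\<close> is perfect, the coefficient of \<open>x\<^sup>p\<^sup>-\<^sup>1\<close> (all exponents \<open>p - 1\<close>) in the
  basis of monomials \<open>e i\<close> is an additive map \<open>T : R \<rightarrow> R\<close> with \<open>T (r\<^sup>p b) = r T b\<close>, and the
  complementary monomials \<open>d i\<close> form the dual basis: \<open>T (d i e j)\<close> is \<open>1\<close> if \<open>i = j\<close> and \<open>0\<close>
  otherwise. Thus Frobenius makes \<open>R\<close> a free Frobenius extension of itself. For any such extension
  \<open>A \<rightarrow> B\<close>, contracting with \<open>T\<close> gives \<open>\<kappa> : B \<otimes> N \<rightarrow> N\<close>, \<open>b \<otimes> x \<mapsto> T b x\<close>, and every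
  tensor \<open>X\<close> equals \<open>\<Sum>i. e i \<otimes> \<kappa> (d i X)\<close>. Hence the components of a \<open>B\<close>-linear map \<open>g\<close> into
  \<open>B \<otimes> N\<close> are \<open>m \<mapsto> \<kappa> (g (d i m))\<close>, the top one being \<open>\<kappa> \<circ> g\<close>, and \<open>g \<mapsto> \<kappa> \<circ> g\<close> is inverse to
  \<open>h \<mapsto> (m \<mapsto> \<Sum>i. e i \<otimes> h (d i m))\<close>. That the latter map is \<open>B\<close>-linear is the expansion of
  elements of \<open>B\<close> in the basis \<open>d\<close>.\<close>

section \<open>Additive maps and module isomorphisms\<close>

text \<open>An additive map sends zero to zero by cancellation in \<open>H\<close>. Induction on
  \<open>I\<close> does the rest; a sum over an infinite set is zero on both sides.\<close>

lemma finsum_additive: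
  assumes "abelian_group G" "abelian_group H"
    and h: "h \<in> carrier G \<rightarrow> carrier H"
    and add: "\<And>x y. x \<in> carrier G \<Longrightarrow> y \<in> carrier G \<Longrightarrow> h (x \<oplus>\<^bsub>G\<^esub> y) = h x \<oplus>\<^bsub>H\<^esub> h y"
    and "g \<in> I \<rightarrow> carrier G"
  shows "h (\<Oplus>\<^bsub>G\<^esub>i\<in>I. g i) = (\<Oplus>\<^bsub>H\<^esub>i\<in>I. h (g i))"
proof -
  interpret G: abelian_group G by fact
  interpret H: abelian_group H by fact
  have closed: "h x \<in> carrier H" if "x \<in> carrier G" for x using h that by blast
  have "h \<zero>\<^bsub>G\<^esub> \<oplus>\<^bsub>H\<^esub> h \<zero>\<^bsub>G\<^esub> = h \<zero>\<^bsub>G\<^esub>"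
    using add[of "\<zero>\<^bsub>G\<^esub>" "\<zero>\<^bsub>G\<^esub>"] by simp
  then have zero: "h \<zero>\<^bsub>G\<^esub> = \<zero>\<^bsub>H\<^esub>"
    using closed by (metis G.zero_closed H.add.r_cancel_one')
  show ?thesis
    using \<open>g \<in> I \<rightarrow> carrier G\<close>
    by (induction I rule: infinite_finite_induct) (auto simp: zero add closed Pi_def)
qed

lemma module_homs_closed:
  "h \<in> module_homs R M N \<Longrightarrow> x \<in> carrier M \<Longrightarrow> h x \<in> carrier N"
  by (auto simp: module_homs_def)

text \<open>Linearity of \<open>h\<close> passes to its inverse \<open>k\<close>: a sum or multiple
  in \<open>N\<close> is the image under \<open>h\<close> of the corresponding one in
  \<open>M\<close>, and \<open>k\<close> cancels \<open>h\<close>. Extensionality of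
  \<open>k\<close> is asked for because module homomorphisms are extensional.\<close>

lemma module_isos_inverse:
  assumes M: "module R M"
    and h: "h \<in> module_homs R M N"
    and k: "k \<in> carrier N \<rightarrow>\<^sub>E carrier M"
    and kh: "\<And>x. x \<in> carrier M \<Longrightarrow> k (h x) = x"
    and hk: "\<And>y. y \<in> carrier N \<Longrightarrow> h (k y) = y"
  shows "h \<in> module_isos R M N" and "k \<in> module_isos R N M"
proof -
  interpret M: module R M by fact
  have hc: "h x \<in> carrier N" if "x \<in> carrier M" for x
    using h that by (rule module_homs_closed)
  have kc: "k y \<in> carrier M" if "y \<in> carrier N" for y
    using k that by auto
  show "h \<in> module_isos R M N"
    using h kh hk hc kc unfolding module_isos_def by (auto intro!: bij_betw_byWitness[where f' = k])
  have "k (x \<oplus>\<^bsub>N\<^esub> y) = k x \<oplus>\<^bsub>M\<^esub> k y" if "x \<in> carrier N" "y \<in> carrier N" for x y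
  proof -
    have "x \<oplus>\<^bsub>N\<^esub> y = h (k x \<oplus>\<^bsub>M\<^esub> k y)"
      using h that kc by (simp add: module_homs_def hk)
    then show ?thesis using that kc by (simp add: kh)
  qed
  moreover have "k (r \<odot>\<^bsub>N\<^esub> x) = r \<odot>\<^bsub>M\<^esub> k x" if "r \<in> carrier R" "x \<in> carrier N" for r x
  proof -
    have "r \<odot>\<^bsub>N\<^esub> x = h (r \<odot>\<^bsub>M\<^esub> k x)"
      using h that kc by (simp add: module_homs_def hk)
    then show ?thesis using that kc by (simp add: kh)
  qed
  ultimately show "k \<in> module_isos R N M"
    using k kh hk hc kc unfolding module_isos_def module_homs_def
    by (auto intro!: bij_betw_byWitness[where f' = h])
qed


section \<open>Extension of scalars\<close>

locale scalar_extension =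
  B: cring B + N: module A N
  for A :: "('a, 'c) ring_scheme" and B :: "('b, 'd) ring_scheme" and N :: "('a, 'n) module" +
  fixes f :: "'a \<Rightarrow> 'b"
  assumes f_funcset: "f \<in> carrier A \<rightarrow> carrier B"
begin

abbreviation "E \<equiv> extend_scalars A B f N"
abbreviation "tensor \<equiv> pure_tensor A B f N"

sublocale E: module B E
  by (rule module_extend_scalars[OF B.is_cring N.module_axioms f_funcset])

lemma f_closed [simp]: "a \<in> carrier A \<Longrightarrow> f a \<in> carrier B"
  using f_funcset by blast

section \<open>The tensor product as a quotient of a free abelian group\<close>

lemma carrier_tensor_free_iff:
  "u \<in> carrier (tensor_free B N) \<longleftrightarrow> Poly_Mapping.keys u \<subseteq> carrier B \<times> carrier N"
  by (simp add: tensor_free_def)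

lemma comm_group_tensor_free: "comm_group (tensor_free B N)"
  unfolding tensor_free_def by (rule abelian_free_Abelian_group)

lemma diff_tensor_free_closed:
  assumes "u \<in> carrier (tensor_free B N)" "v \<in> carrier (tensor_free B N)"
  shows "u - v \<in> carrier (tensor_free B N)"
  using assms Poly_Mapping.keys_diff[of u v] unfolding carrier_tensor_free_iff by blast

lemma frag_of_tensor_free_closed:
  "b \<in> carrier B \<Longrightarrow> x \<in> carrier N \<Longrightarrow> frag_of (b, x) \<in> carrier (tensor_free B N)"
  by (simp add: carrier_tensor_free_iff)

lemma tensor_relators_closed: "tensor_relators A B f N \<subseteq> carrier (tensor_free B N)"
  unfolding tensor_relators_def by (auto intro!: diff_tensor_free_closed frag_of_tensor_free_closed)

lemma tensor_kernel_subgroup: "subgroup (tensor_kernel A B f N) (tensor_free B N)"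
  unfolding tensor_kernel_def
  using comm_group.axioms(2)[OF comm_group_tensor_free] tensor_relators_closed
  by (rule group.generate_is_subgroup)

lemma tensor_kernel_normal: "tensor_kernel A B f N \<lhd> tensor_free B N"
  using comm_group.axioms(2)[OF comm_group_tensor_free] comm_group_tensor_free tensor_kernel_subgroup
  by (simp add: comm_group.normal_iff_subgroup)

lemma E_simps:
  "carrier E = carrier (tensor_free B N Mod tensor_kernel A B f N)"
  "\<zero>\<^bsub>E\<^esub> = \<one>\<^bsub>tensor_free B N Mod tensor_kernel A B f N\<^esub>"
  "X \<oplus>\<^bsub>E\<^esub> Y = X \<otimes>\<^bsub>tensor_free B N Mod tensor_kernel A B f N\<^esub> Y"
  "r \<odot>\<^bsub>E\<^esub> X = (\<Union>u \<in> X. tensor_kernel A B f N #>\<^bsub>tensor_free B N\<^esub> tensor_act B r u)"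
  by (simp_all add: extend_scalars_def Let_def)

abbreviation "coset u \<equiv> tensor_kernel A B f N #>\<^bsub>tensor_free B N\<^esub> u"

lemma coset_closed: "u \<in> carrier (tensor_free B N) \<Longrightarrow> coset u \<in> carrier E"
  by (auto simp: E_simps carrier_FactGroup)

lemma coset_add:
  assumes "u \<in> carrier (tensor_free B N)" "v \<in> carrier (tensor_free B N)"
  shows "coset u \<oplus>\<^bsub>E\<^esub> coset v = coset (u + v)"
  using normal.rcos_sum[OF tensor_kernel_normal assms]
  by (simp add: E_simps) (simp add: tensor_free_def)

text \<open>Relators are differences, and induction over the free abelian group proceeds by
  differences, so subtraction gets its own rule.\<close>

lemma coset_diff:
  assumes "u \<in> carrier (tensor_free B N)" "v \<in> carrier (tensor_free B N)"
  shows "coset (u - v) = coset u \<ominus>\<^bsub>E\<^esub> coset v"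
proof -
  have d: "u - v \<in> carrier (tensor_free B N)"
    by (rule diff_tensor_free_closed[OF assms])
  then have "coset u = coset (u - v) \<oplus>\<^bsub>E\<^esub> coset v"
    by (simp add: coset_add[OF d assms(2)])
  then show ?thesis
    using assms d coset_closed by (simp add: E.M.minus_eq E.M.a_assoc E.M.r_neg)
qed

lemma coset_relator:
  assumes "u \<in> tensor_relators A B f N"
  shows "coset u = \<zero>\<^bsub>E\<^esub>"
proof -
  have "u \<in> tensor_kernel A B f N"
    using assms by (simp add: tensor_kernel_def generate.incl)
  then show ?thesis
    using subgroup.rcos_const[OF tensor_kernel_subgroup comm_group.axioms(2)[OF comm_group_tensor_free]]
    by (simp add: E_simps)
qed

lemma coset_eqI:
  assumes "u \<in> carrier (tensor_free B N)" "v \<in> carrier (tensor_free B N)"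
    and "u - v \<in> tensor_relators A B f N"
  shows "coset u = coset v"
  using coset_relator[OF assms(3)] coset_diff[OF assms(1,2)] coset_closed assms(1,2)
  by (metis E.M.minus_eq E.M.minus_minus E.M.minus_equality E.M.a_inv_closed)

section \<open>Rules for pure tensors\<close>

lemma tensor_closed [simp]:
  "b \<in> carrier B \<Longrightarrow> x \<in> carrier N \<Longrightarrow> tensor b x \<in> carrier E"
  unfolding pure_tensor_def by (intro coset_closed frag_of_tensor_free_closed)

lemma tensor_add_left:
  assumes "b \<in> carrier B" "c \<in> carrier B" "x \<in> carrier N"
  shows "tensor (b \<oplus>\<^bsub>B\<^esub> c) x = tensor b x \<oplus>\<^bsub>E\<^esub> tensor c x"
proof -
  have "frag_of (b \<oplus>\<^bsub>B\<^esub> c, x) - (frag_of (b, x) + frag_of (c, x)) \<in> tensor_relators A B f N"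
    unfolding tensor_relators_def diff_diff_eq[symmetric] using assms by blast
  moreover have "frag_of (b, x) + frag_of (c, x) \<in> carrier (tensor_free B N)"
    using assms keys_add[of "frag_of (b, x)" "frag_of (c, x)"]
    by (auto simp: carrier_tensor_free_iff)
  ultimately show ?thesis
    unfolding pure_tensor_def using assms
    by (simp add: coset_add frag_of_tensor_free_closed coset_eqI)
qed

lemma tensor_add_right:
  assumes "b \<in> carrier B" "x \<in> carrier N" "y \<in> carrier N"
  shows "tensor b (x \<oplus>\<^bsub>N\<^esub> y) = tensor b x \<oplus>\<^bsub>E\<^esub> tensor b y"
proof -
  have "frag_of (b, x \<oplus>\<^bsub>N\<^esub> y) - (frag_of (b, x) + frag_of (b, y)) \<in> tensor_relators A B f N"
    unfolding tensor_relators_def diff_diff_eq[symmetric] using assms by blast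
  moreover have "frag_of (b, x) + frag_of (b, y) \<in> carrier (tensor_free B N)"
    using assms keys_add[of "frag_of (b, x)" "frag_of (b, y)"]
    by (auto simp: carrier_tensor_free_iff)
  ultimately show ?thesis
    unfolding pure_tensor_def using assms
    by (simp add: coset_add frag_of_tensor_free_closed coset_eqI)
qed

lemma tensor_balanced:
  assumes "a \<in> carrier A" "b \<in> carrier B" "x \<in> carrier N"
  shows "tensor b (a \<odot>\<^bsub>N\<^esub> x) = tensor (f a \<otimes>\<^bsub>B\<^esub> b) x"
proof -
  have "frag_of (f a \<otimes>\<^bsub>B\<^esub> b, x) - frag_of (b, a \<odot>\<^bsub>N\<^esub> x) \<in> tensor_relators A B f N"
    unfolding tensor_relators_def using assms by blast
  then show ?thesis
    unfolding pure_tensor_def using assms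
    by (intro coset_eqI[symmetric] frag_of_tensor_free_closed) auto
qed

lemma smult_tensor:
  assumes "r \<in> carrier B" "b \<in> carrier B" "x \<in> carrier N"
  shows "r \<odot>\<^bsub>E\<^esub> tensor b x = tensor (r \<otimes>\<^bsub>B\<^esub> b) x"
proof -
  interpret G: comm_group "tensor_free B N" by (rule comm_group_tensor_free)
  have rb: "frag_of (r \<otimes>\<^bsub>B\<^esub> b, x) \<in> carrier (tensor_free B N)"
    using assms by (simp add: frag_of_tensor_free_closed)
  have "frag_of (b, x) \<in> tensor b x"
    unfolding pure_tensor_def using assms
    by (intro G.rcos_self frag_of_tensor_free_closed tensor_kernel_subgroup)
  \<comment> \<open>The union defining \<open>r \<odot> tensor b x\<close> is a coset because \<open>E\<close> is a module, so one element identifies it.\<close>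
  then have "coset (tensor_act B r (frag_of (b, x))) \<subseteq> r \<odot>\<^bsub>E\<^esub> tensor b x"
    unfolding E_simps by blast
  then have "frag_of (r \<otimes>\<^bsub>B\<^esub> b, x) \<in> r \<odot>\<^bsub>E\<^esub> tensor b x"
    using G.rcos_self[OF rb tensor_kernel_subgroup] by (auto simp: tensor_act_def)
  moreover obtain u where "u \<in> carrier (tensor_free B N)" "r \<odot>\<^bsub>E\<^esub> tensor b x = coset u"
    using E.smult_closed[OF assms(1) tensor_closed[OF assms(2,3)]]
    by (auto simp: E_simps(1) carrier_FactGroup)
  ultimately show ?thesis
    unfolding pure_tensor_def
    using G.repr_independence[OF _ _ tensor_kernel_subgroup] by metis
qed

lemma tensor_zero_left: "x \<in> carrier N \<Longrightarrow> tensor \<zero>\<^bsub>B\<^esub> x = \<zero>\<^bsub>E\<^esub>"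
  using smult_tensor[of "\<zero>\<^bsub>B\<^esub>" "\<zero>\<^bsub>B\<^esub>" x] E.smult_l_null[of "tensor \<zero>\<^bsub>B\<^esub> x"] by simp

lemma tensor_minus_left:
  "b \<in> carrier B \<Longrightarrow> x \<in> carrier N \<Longrightarrow> tensor (\<ominus>\<^bsub>B\<^esub> b) x = \<ominus>\<^bsub>E\<^esub> tensor b x"
  using tensor_add_left[of "\<ominus>\<^bsub>B\<^esub> b" b x]
  by (simp add: B.l_neg tensor_zero_left E.M.minus_equality)

lemma tensor_finsum_left:
  assumes "b \<in> I \<rightarrow> carrier B" "x \<in> carrier N"
  shows "tensor (\<Oplus>\<^bsub>B\<^esub>i\<in>I. b i) x = (\<Oplus>\<^bsub>E\<^esub>i\<in>I. tensor (b i) x)"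
  using assms
  by (intro finsum_additive[where h = "\<lambda>b. tensor b x"] B.is_abelian_group E.M.abelian_group_axioms)
    (auto simp: tensor_add_left)

section \<open>Generation by pure tensors and the universal property\<close>

text \<open>Pure tensors generate under addition alone, because \<open>-(b \<otimes> x)\<close> is
  the pure tensor \<open>(-b) \<otimes> x\<close> and zero is \<open>0 \<otimes> 0\<close>.\<close>

lemma tensor_induct [consumes 1, case_names add tensor]:
  assumes "X \<in> carrier E"
    and add: "\<And>X Y. X \<in> carrier E \<Longrightarrow> Y \<in> carrier E \<Longrightarrow> P X \<Longrightarrow> P Y \<Longrightarrow> P (X \<oplus>\<^bsub>E\<^esub> Y)"
    and tensor: "\<And>b x. b \<in> carrier B \<Longrightarrow> x \<in> carrier N \<Longrightarrow> P (tensor b x)"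
  shows "P X"
proof -
  obtain u where u: "u \<in> carrier (tensor_free B N)" and X: "X = coset u"
    using assms(1) by (auto simp: E_simps(1) carrier_FactGroup)
  have 0: "coset 0 = \<zero>\<^bsub>E\<^esub>"
    using coset_diff[OF u u] coset_closed[OF u] by (simp add: E.M.r_neg E.M.minus_eq)
  have P0: "P \<zero>\<^bsub>E\<^esub>"
    using tensor[of "\<zero>\<^bsub>B\<^esub>" "\<zero>\<^bsub>N\<^esub>"] by (simp add: tensor_zero_left)
  \<comment> \<open>The induction on \<open>u\<close> forms differences, whereas \<open>P\<close> is
    only known to pass to sums; carrying the opposite coset along closes this gap.\<close>
  from u[unfolded carrier_tensor_free_iff] have "P (coset u) \<and> P (\<ominus>\<^bsub>E\<^esub> coset u)"
  proof (induction u rule: free_Abelian_group_induct[consumes 1, case_names zero diff frag_of])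
    case zero
    have minus_zero: "\<ominus>\<^bsub>E\<^esub> \<zero>\<^bsub>E\<^esub> = \<zero>\<^bsub>E\<^esub>"
      by (rule E.M.minus_equality) simp_all
    show ?case using P0 unfolding 0 minus_zero by simp
  next
    case (diff u v)
    then show ?case
      using add[of "coset u" "\<ominus>\<^bsub>E\<^esub> coset v"] add[of "\<ominus>\<^bsub>E\<^esub> coset u" "coset v"] coset_closed
      by (simp add: coset_diff carrier_tensor_free_iff E.M.minus_eq E.M.minus_add)
  next
    case (frag_of z)
    then obtain b x where z: "z = (b, x)" "b \<in> carrier B" "x \<in> carrier N"
      by auto
    then have "P (tensor b x) \<and> P (\<ominus>\<^bsub>E\<^esub> tensor b x)"
      using tensor[of b x] tensor[of "\<ominus>\<^bsub>B\<^esub> b" x] by (simp add: tensor_minus_left)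
    then show ?case by (simp add: z pure_tensor_def)
  qed
  then show ?thesis by (simp add: X)
qed

text \<open>The additive extension of \<open>\<phi>\<close> to the free abelian group kills the
  relators, hence the subgroup they generate, and descends to the quotient.\<close>

lemma tensor_universal:
  fixes P :: "('e, 'g) ring_scheme" and \<phi> :: "'b \<Rightarrow> 'n \<Rightarrow> 'e"
  assumes "abelian_group P"
    and closed: "\<And>b x. b \<in> carrier B \<Longrightarrow> x \<in> carrier N \<Longrightarrow> \<phi> b x \<in> carrier P"
    and add_left: "\<And>b c x. b \<in> carrier B \<Longrightarrow> c \<in> carrier B \<Longrightarrow> x \<in> carrier N \<Longrightarrow>
      \<phi> (b \<oplus>\<^bsub>B\<^esub> c) x = \<phi> b x \<oplus>\<^bsub>P\<^esub> \<phi> c x"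
    and add_right: "\<And>b x y. b \<in> carrier B \<Longrightarrow> x \<in> carrier N \<Longrightarrow> y \<in> carrier N \<Longrightarrow>
      \<phi> b (x \<oplus>\<^bsub>N\<^esub> y) = \<phi> b x \<oplus>\<^bsub>P\<^esub> \<phi> b y"
    and balanced: "\<And>a b x. a \<in> carrier A \<Longrightarrow> b \<in> carrier B \<Longrightarrow> x \<in> carrier N \<Longrightarrow>
      \<phi> (f a \<otimes>\<^bsub>B\<^esub> b) x = \<phi> b (a \<odot>\<^bsub>N\<^esub> x)"
  obtains \<kappa> where "\<kappa> \<in> carrier E \<rightarrow> carrier P"
    and "\<And>X Y. X \<in> carrier E \<Longrightarrow> Y \<in> carrier E \<Longrightarrow> \<kappa> (X \<oplus>\<^bsub>E\<^esub> Y) = \<kappa> X \<oplus>\<^bsub>P\<^esub> \<kappa> Y"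
    and "\<And>b x. b \<in> carrier B \<Longrightarrow> x \<in> carrier N \<Longrightarrow> \<kappa> (tensor b x) = \<phi> b x"
proof -
  interpret P: abelian_group P by fact
  obtain h where h: "h \<in> hom (tensor_free B N) (add_monoid P)"
    and h_frag: "\<And>z. z \<in> carrier B \<times> carrier N \<Longrightarrow> h (frag_of z) = case_prod \<phi> z"
    using comm_group.free_Abelian_group_universal[OF P.a_comm_group, of "case_prod \<phi>"
        "carrier B \<times> carrier N"] closed
    unfolding tensor_free_def by (auto simp: image_subset_iff)
  interpret h: group_hom "tensor_free B N" "add_monoid P" h
    using h P.a_group comm_group.axioms(2)[OF comm_group_tensor_free]
    by (simp add: group_hom_def group_hom_axioms_def)
  have h_closed: "h u \<in> carrier P" if "u \<in> carrier (tensor_free B N)" for u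
    using h.hom_closed[OF that] by simp
  have h_diff: "h (u - v) = h u \<ominus>\<^bsub>P\<^esub> h v"
    if u: "u \<in> carrier (tensor_free B N)" and v: "v \<in> carrier (tensor_free B N)" for u v
  proof -
    have d: "u - v \<in> carrier (tensor_free B N)" by (rule diff_tensor_free_closed[OF u v])
    have "h u = h (u - v) \<oplus>\<^bsub>P\<^esub> h v"
      using h.hom_mult[OF d v] by (simp add: tensor_free_def)
    then show ?thesis
      using h_closed[OF d] h_closed[OF v] by (simp add: P.minus_eq P.a_assoc P.r_neg)
  qed
  \<comment> \<open>This settles the images of the biadditivity relators, which have the form
    \<open>(x + y) - x - y\<close>.\<close>
  have cancel: "x \<oplus>\<^bsub>P\<^esub> (y \<oplus>\<^bsub>P\<^esub> (\<ominus>\<^bsub>P\<^esub> x \<oplus>\<^bsub>P\<^esub> \<ominus>\<^bsub>P\<^esub> y)) = \<zero>\<^bsub>P\<^esub>"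
    if "x \<in> carrier P" "y \<in> carrier P" for x y
    using that by (simp add: P.minus_add[symmetric] P.a_assoc[symmetric] P.r_neg)
  have "h u = \<zero>\<^bsub>P\<^esub>" if "u \<in> tensor_relators A B f N" for u
    using that unfolding tensor_relators_def
    by (auto simp: h_diff frag_of_tensor_free_closed diff_tensor_free_closed h_frag add_left
        add_right balanced closed P.minus_eq P.a_ac P.r_neg cancel)
  then have "tensor_relators A B f N \<subseteq> kernel (tensor_free B N) (add_monoid P) h"
    using tensor_relators_closed by (auto simp: kernel_def)
  then have "tensor_kernel A B f N \<subseteq> kernel (tensor_free B N) (add_monoid P) h"
    unfolding tensor_kernel_def
    by (intro h.generate_subgroup_incl h.subgroup_kernel)
  then obtain \<kappa> where \<kappa>: "\<kappa> \<in> hom (tensor_free B N Mod tensor_kernel A B f N) (add_monoid P)"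
    and "\<And>u. u \<in> carrier (tensor_free B N) \<Longrightarrow> \<kappa> (coset u) = h u"
    using h.FactGroup_universal_kernel[OF tensor_kernel_normal] by blast
  then show ?thesis
    using h_frag by (intro that[of \<kappa>])
      (auto simp: E_simps pure_tensor_def frag_of_tensor_free_closed hom_def simp del: mult_FactGroup)
qed

end


section \<open>Free Frobenius extensions\<close>

text \<open>A free Frobenius extension with Frobenius form \<open>T\<close> and dual bases
  \<open>e\<close> and \<open>d\<close>. Since \<open>d t\<close> is one, \<open>T\<close> itself is
  the coordinate function at \<open>e t\<close>, which is what makes contraction the component at
  \<open>t\<close>.\<close>

locale frobenius_extension =
  scalar_extension A B N f + M: module B M
  for A :: "('a, 'c) ring_scheme" and B :: "('b, 'd) ring_scheme" and N :: "('a, 'n) module"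
    and f :: "'a \<Rightarrow> 'b" and M :: "('b, 'm) module" +
  fixes T :: "'b \<Rightarrow> 'a" and I :: "'i set" and e d :: "'i \<Rightarrow> 'b" and t :: 'i
  assumes T_funcset: "T \<in> carrier B \<rightarrow> carrier A"
    and T_add: "b \<in> carrier B \<Longrightarrow> c \<in> carrier B \<Longrightarrow> T (b \<oplus>\<^bsub>B\<^esub> c) = T b \<oplus>\<^bsub>A\<^esub> T c"
    and T_smult: "a \<in> carrier A \<Longrightarrow> b \<in> carrier B \<Longrightarrow> T (f a \<otimes>\<^bsub>B\<^esub> b) = a \<otimes>\<^bsub>A\<^esub> T b"
    and finite_I: "finite I"
    and e_funcset: "e \<in> I \<rightarrow> carrier B"
    and d_funcset: "d \<in> I \<rightarrow> carrier B"
    and basis_expansion: "b \<in> carrier B \<Longrightarrow> (\<Oplus>\<^bsub>B\<^esub>i\<in>I. f (T (d i \<otimes>\<^bsub>B\<^esub> b)) \<otimes>\<^bsub>B\<^esub> e i) = b"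
    and dual_basis: "i \<in> I \<Longrightarrow> j \<in> I \<Longrightarrow> T (d i \<otimes>\<^bsub>B\<^esub> e j) = (if i = j then \<one>\<^bsub>A\<^esub> else \<zero>\<^bsub>A\<^esub>)"
    and t_in_I: "t \<in> I"
    and d_t: "d t = \<one>\<^bsub>B\<^esub>"
begin

lemma T_closed [simp]: "b \<in> carrier B \<Longrightarrow> T b \<in> carrier A"
  using T_funcset by blast

lemma e_closed [simp]: "i \<in> I \<Longrightarrow> e i \<in> carrier B"
  using e_funcset by blast

lemma d_closed [simp]: "i \<in> I \<Longrightarrow> d i \<in> carrier B"
  using d_funcset by blast

lemma T_smult_middle:
  "a \<in> carrier A \<Longrightarrow> b \<in> carrier B \<Longrightarrow> c \<in> carrier B \<Longrightarrow>
    T (c \<otimes>\<^bsub>B\<^esub> (f a \<otimes>\<^bsub>B\<^esub> b)) = a \<otimes>\<^bsub>A\<^esub> T (c \<otimes>\<^bsub>B\<^esub> b)"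
  using B.m_lcomm[of c "f a" b] T_smult[of a "c \<otimes>\<^bsub>B\<^esub> b"] by simp

lemma T_finsum: "g \<in> J \<rightarrow> carrier B \<Longrightarrow> T (\<Oplus>\<^bsub>B\<^esub>i\<in>J. g i) = (\<Oplus>\<^bsub>A\<^esub>i\<in>J. T (g i))"
  by (intro finsum_additive B.is_abelian_group N.R.is_abelian_group T_funcset T_add)

text \<open>The families \<open>e\<close> and \<open>d\<close> can be interchanged, because the form
  \<open>(b, c) \<mapsto> T (b c)\<close> is symmetric and, by the expansion in the basis \<open>e\<close>, nondegenerate.\<close>

lemma dual_basis_expansion:
  assumes b: "b \<in> carrier B"
  shows "(\<Oplus>\<^bsub>B\<^esub>i\<in>I. f (T (b \<otimes>\<^bsub>B\<^esub> e i)) \<otimes>\<^bsub>B\<^esub> d i) = b" (is "?b' = b")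
proof -
  have b': "?b' \<in> carrier B"
    using b by (intro B.finsum_closed) auto
  have "T (c \<otimes>\<^bsub>B\<^esub> ?b') = T (c \<otimes>\<^bsub>B\<^esub> b)" if c: "c \<in> carrier B" for c
  proof -
    have "T (c \<otimes>\<^bsub>B\<^esub> b) = T ((\<Oplus>\<^bsub>B\<^esub>i\<in>I. f (T (d i \<otimes>\<^bsub>B\<^esub> c)) \<otimes>\<^bsub>B\<^esub> e i) \<otimes>\<^bsub>B\<^esub> b)"
      by (simp only: basis_expansion[OF c])
    also have "\<dots> = T (\<Oplus>\<^bsub>B\<^esub>i\<in>I. f (T (d i \<otimes>\<^bsub>B\<^esub> c)) \<otimes>\<^bsub>B\<^esub> (e i \<otimes>\<^bsub>B\<^esub> b))"
      using b c
      by (subst B.finsum_ldistr) (auto simp: finite_I B.m_assoc intro!: arg_cong[of _ _ T] B.finsum_cong')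
    also have "\<dots> = (\<Oplus>\<^bsub>A\<^esub>i\<in>I. T (d i \<otimes>\<^bsub>B\<^esub> c) \<otimes>\<^bsub>A\<^esub> T (e i \<otimes>\<^bsub>B\<^esub> b))"
      using b c by (subst T_finsum) (auto simp: T_smult intro!: N.R.finsum_cong')
    \<comment> \<open>Commutativity of both rings regroups the factors so that
      \<open>T (b e i)\<close>, the prospective coordinate of \<open>b\<close> at
      \<open>d i\<close>, stands in front.\<close>
    also have "\<dots> = (\<Oplus>\<^bsub>A\<^esub>i\<in>I. T (b \<otimes>\<^bsub>B\<^esub> e i) \<otimes>\<^bsub>A\<^esub> T (c \<otimes>\<^bsub>B\<^esub> d i))"
      using b c by (intro N.R.finsum_cong') (auto simp: B.m_comm N.R.m_comm)
    also have "\<dots> = T (\<Oplus>\<^bsub>B\<^esub>i\<in>I. c \<otimes>\<^bsub>B\<^esub> (f (T (b \<otimes>\<^bsub>B\<^esub> e i)) \<otimes>\<^bsub>B\<^esub> d i))"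
      using b c by (subst T_finsum) (auto simp: T_smult_middle intro!: N.R.finsum_cong')
    also have "\<dots> = T (c \<otimes>\<^bsub>B\<^esub> ?b')"
      using b c by (simp add: B.finsum_rdistr finite_I Pi_def)
    finally show ?thesis by simp
  qed
  \<comment> \<open>Taking \<open>c = d i\<close> shows that \<open>?b'\<close> and \<open>b\<close>
    have the same coordinates in the basis \<open>e\<close>.\<close>
  then have "(\<Oplus>\<^bsub>B\<^esub>i\<in>I. f (T (d i \<otimes>\<^bsub>B\<^esub> ?b')) \<otimes>\<^bsub>B\<^esub> e i) = (\<Oplus>\<^bsub>B\<^esub>i\<in>I. f (T (d i \<otimes>\<^bsub>B\<^esub> b)) \<otimes>\<^bsub>B\<^esub> e i)"
    using b by (intro B.finsum_cong') auto
  then show ?thesis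
    by (simp only: basis_expansion b b')
qed

section \<open>Contraction and the coordinates of a tensor\<close>

text \<open>Since pure tensors generate \<open>E\<close>, the conditions fix the values on the
  carrier; the choice only concerns values elsewhere.\<close>

definition contraction :: "('b \<times> 'n \<Rightarrow>\<^sub>0 int) set \<Rightarrow> 'n" where
  "contraction = (SOME \<kappa>. \<kappa> \<in> carrier E \<rightarrow> carrier N \<and>
     (\<forall>X \<in> carrier E. \<forall>Y \<in> carrier E. \<kappa> (X \<oplus>\<^bsub>E\<^esub> Y) = \<kappa> X \<oplus>\<^bsub>N\<^esub> \<kappa> Y) \<and>
     (\<forall>b \<in> carrier B. \<forall>x \<in> carrier N. \<kappa> (tensor b x) = T b \<odot>\<^bsub>N\<^esub> x))"

lemma contraction_spec:
  "contraction \<in> carrier E \<rightarrow> carrier N \<and>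
   (\<forall>X \<in> carrier E. \<forall>Y \<in> carrier E. contraction (X \<oplus>\<^bsub>E\<^esub> Y) = contraction X \<oplus>\<^bsub>N\<^esub> contraction Y) \<and>
   (\<forall>b \<in> carrier B. \<forall>x \<in> carrier N. contraction (tensor b x) = T b \<odot>\<^bsub>N\<^esub> x)"
proof -
  \<comment> \<open>Balancedness of \<open>b \<otimes> x \<mapsto> T b x\<close>; it rests on the
    commutativity of \<open>A\<close>.\<close>
  have bal: "(a \<otimes>\<^bsub>A\<^esub> T b) \<odot>\<^bsub>N\<^esub> x = T b \<odot>\<^bsub>N\<^esub> (a \<odot>\<^bsub>N\<^esub> x)"
    if "a \<in> carrier A" "b \<in> carrier B" "x \<in> carrier N" for a b x
    using that by (simp add: N.smult_assoc1[symmetric] N.R.m_comm)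
  have "\<exists>\<kappa>. \<kappa> \<in> carrier E \<rightarrow> carrier N \<and>
     (\<forall>X \<in> carrier E. \<forall>Y \<in> carrier E. \<kappa> (X \<oplus>\<^bsub>E\<^esub> Y) = \<kappa> X \<oplus>\<^bsub>N\<^esub> \<kappa> Y) \<and>
     (\<forall>b \<in> carrier B. \<forall>x \<in> carrier N. \<kappa> (tensor b x) = T b \<odot>\<^bsub>N\<^esub> x)"
    by (rule tensor_universal[of N "\<lambda>b x. T b \<odot>\<^bsub>N\<^esub> x"])
      (auto simp: N.M.abelian_group_axioms T_add T_smult N.smult_l_distr N.smult_r_distr bal)
  from someI_ex[OF this] show ?thesis
    unfolding contraction_def[symmetric] .
qed

lemma contraction_closed [simp]: "X \<in> carrier E \<Longrightarrow> contraction X \<in> carrier N"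
  using contraction_spec by blast

lemma contraction_add:
  "X \<in> carrier E \<Longrightarrow> Y \<in> carrier E \<Longrightarrow> contraction (X \<oplus>\<^bsub>E\<^esub> Y) = contraction X \<oplus>\<^bsub>N\<^esub> contraction Y"
  using contraction_spec by blast

lemma contraction_tensor:
  "b \<in> carrier B \<Longrightarrow> x \<in> carrier N \<Longrightarrow> contraction (tensor b x) = T b \<odot>\<^bsub>N\<^esub> x"
  using contraction_spec by blast

lemma contraction_finsum:
  "g \<in> J \<rightarrow> carrier E \<Longrightarrow> contraction (\<Oplus>\<^bsub>E\<^esub>i\<in>J. g i) = (\<Oplus>\<^bsub>N\<^esub>i\<in>J. contraction (g i))"
  by (intro finsum_additive E.M.abelian_group_axioms N.M.abelian_group_axioms)
    (auto simp: contraction_add)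

lemma contraction_smult:
  assumes "a \<in> carrier A" "X \<in> carrier E"
  shows "contraction (f a \<odot>\<^bsub>E\<^esub> X) = a \<odot>\<^bsub>N\<^esub> contraction X"
  using assms(2)
proof (induction rule: tensor_induct)
  case (add X Y)
  then show ?case
    using assms(1) by (simp add: E.smult_r_distr contraction_add N.smult_r_distr)
next
  case (tensor b x)
  then show ?case
    using assms(1) by (simp add: smult_tensor contraction_tensor T_smult N.smult_assoc1)
qed

text \<open>Both sides are additive in \<open>X\<close>. For \<open>X = b \<otimes> x\<close> the
  scalar \<open>T (d i b)\<close> moves across the tensor sign to \<open>e i\<close>, and the sum
  becomes the expansion of \<open>b\<close> in the basis \<open>e\<close>.\<close>

lemma tensor_expansion:
  assumes "X \<in> carrier E"
  shows "(\<Oplus>\<^bsub>E\<^esub>i\<in>I. tensor (e i) (contraction (d i \<odot>\<^bsub>E\<^esub> X))) = X"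
  using assms
proof (induction rule: tensor_induct)
  case (add X Y)
  have "(\<Oplus>\<^bsub>E\<^esub>i\<in>I. tensor (e i) (contraction (d i \<odot>\<^bsub>E\<^esub> (X \<oplus>\<^bsub>E\<^esub> Y)))) =
    (\<Oplus>\<^bsub>E\<^esub>i\<in>I. tensor (e i) (contraction (d i \<odot>\<^bsub>E\<^esub> X)) \<oplus>\<^bsub>E\<^esub> tensor (e i) (contraction (d i \<odot>\<^bsub>E\<^esub> Y)))"
    using add by (intro E.M.finsum_cong') (auto simp: E.smult_r_distr contraction_add tensor_add_right)
  also have "\<dots> = X \<oplus>\<^bsub>E\<^esub> Y"
    using add by (subst E.M.finsum_addf) auto
  finally show ?case .
next
  case (tensor b x)
  have "(\<Oplus>\<^bsub>E\<^esub>i\<in>I. tensor (e i) (contraction (d i \<odot>\<^bsub>E\<^esub> tensor b x))) =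
    (\<Oplus>\<^bsub>E\<^esub>i\<in>I. tensor (f (T (d i \<otimes>\<^bsub>B\<^esub> b)) \<otimes>\<^bsub>B\<^esub> e i) x)"
    using tensor
    by (intro E.M.finsum_cong') (auto simp: smult_tensor contraction_tensor tensor_balanced)
  also have "\<dots> = tensor (\<Oplus>\<^bsub>B\<^esub>i\<in>I. f (T (d i \<otimes>\<^bsub>B\<^esub> b)) \<otimes>\<^bsub>B\<^esub> e i) x"
    using tensor by (subst tensor_finsum_left) auto
  finally show ?case
    using tensor by (simp add: basis_expansion)
qed

text \<open>Used twice: \<open>b = d j\<close> reads off a coordinate, and \<open>b = d j r\<close>
  computes a coordinate after multiplication by \<open>r\<close>.\<close>

lemma contraction_smult_expansion:
  assumes "b \<in> carrier B" "x \<in> I \<rightarrow> carrier N"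
  shows "contraction (b \<odot>\<^bsub>E\<^esub> (\<Oplus>\<^bsub>E\<^esub>i\<in>I. tensor (e i) (x i))) = (\<Oplus>\<^bsub>N\<^esub>i\<in>I. T (b \<otimes>\<^bsub>B\<^esub> e i) \<odot>\<^bsub>N\<^esub> x i)"
proof -
  have x: "x i \<in> carrier N" if "i \<in> I" for i
    using assms(2) that by blast
  have "b \<odot>\<^bsub>E\<^esub> (\<Oplus>\<^bsub>E\<^esub>i\<in>I. tensor (e i) (x i)) = (\<Oplus>\<^bsub>E\<^esub>i\<in>I. tensor (b \<otimes>\<^bsub>B\<^esub> e i) (x i))"
    using assms x
    by (subst E.finsum_smult_ldistr) (simp_all add: finite_I smult_tensor Pi_def cong: E.M.finsum_cong)
  then show ?thesis
    using assms(1) x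
    by (simp add: contraction_finsum Pi_def)
      (auto simp: contraction_tensor intro!: N.M.finsum_cong')
qed

text \<open>Duality of \<open>d\<close> and \<open>e\<close> leaves only the term with index
  \<open>j\<close>.\<close>

lemma contraction_component:
  assumes "j \<in> I" "x \<in> I \<rightarrow> carrier N"
  shows "contraction (d j \<odot>\<^bsub>E\<^esub> (\<Oplus>\<^bsub>E\<^esub>i\<in>I. tensor (e i) (x i))) = x j"
proof -
  have "(\<Oplus>\<^bsub>N\<^esub>i\<in>I. T (d j \<otimes>\<^bsub>B\<^esub> e i) \<odot>\<^bsub>N\<^esub> x i) = (\<Oplus>\<^bsub>N\<^esub>i\<in>I. if j = i then x i else \<zero>\<^bsub>N\<^esub>)"
    using assms by (intro N.M.finsum_cong') (auto simp: dual_basis Pi_def)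
  then show ?thesis
    using assms by (simp add: contraction_smult_expansion N.M.finsum_singleton finite_I)
qed

text \<open>A tensor is rebuilt from its coordinates by \<open>tensor_expansion\<close>, so
  equations in \<open>E\<close> can be checked coordinatewise in \<open>N\<close>.\<close>

lemma tensor_eqI:
  assumes "X \<in> carrier E" "Y \<in> carrier E"
    and "\<And>i. i \<in> I \<Longrightarrow> contraction (d i \<odot>\<^bsub>E\<^esub> X) = contraction (d i \<odot>\<^bsub>E\<^esub> Y)"
  shows "X = Y"
proof -
  have "(\<Oplus>\<^bsub>E\<^esub>i\<in>I. tensor (e i) (contraction (d i \<odot>\<^bsub>E\<^esub> X))) =
    (\<Oplus>\<^bsub>E\<^esub>i\<in>I. tensor (e i) (contraction (d i \<odot>\<^bsub>E\<^esub> Y)))"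
    using assms by (intro E.M.finsum_cong') auto
  then show ?thesis
    using assms by (simp add: tensor_expansion)
qed

section \<open>The two maps between the Hom modules\<close>

text \<open>This is the component of \<open>g\<close> at \<open>t\<close>: as \<open>d t\<close> is
  one, contracting \<open>d t\<close> times \<open>g m\<close> is contracting
  \<open>g m\<close>.\<close>

definition push_hom :: "('m \<Rightarrow> ('b \<times> 'n \<Rightarrow>\<^sub>0 int) set) \<Rightarrow> 'm \<Rightarrow> 'n" where
  "push_hom g = (\<lambda>m \<in> carrier M. contraction (g m))"

definition pull_hom :: "('m \<Rightarrow> 'n) \<Rightarrow> 'm \<Rightarrow> ('b \<times> 'n \<Rightarrow>\<^sub>0 int) set" where
  "pull_hom h = (\<lambda>m \<in> carrier M. \<Oplus>\<^bsub>E\<^esub>i\<in>I. tensor (e i) (h (d i \<odot>\<^bsub>M\<^esub> m)))"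

lemma module_homs_restrict_iff:
  "h \<in> module_homs A (restrict_scalars f M) N \<longleftrightarrow>
    h \<in> carrier M \<rightarrow>\<^sub>E carrier N \<and>
    (\<forall>x \<in> carrier M. \<forall>y \<in> carrier M. h (x \<oplus>\<^bsub>M\<^esub> y) = h x \<oplus>\<^bsub>N\<^esub> h y) \<and>
    (\<forall>a \<in> carrier A. \<forall>x \<in> carrier M. h (f a \<odot>\<^bsub>M\<^esub> x) = a \<odot>\<^bsub>N\<^esub> h x)"
  by (simp add: module_homs_def restrict_scalars_def)

text \<open>Multiplication by \<open>b\<close> commutes with that by \<open>f a\<close> since
  \<open>B\<close> is commutative. The case \<open>b = d i\<close> gives the components of
  \<open>g\<close>, the case \<open>b = 1\<close> gives \<open>push_hom g\<close>.\<close>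

lemma component_hom:
  assumes g: "g \<in> module_homs B M E" and b: "b \<in> carrier B"
  shows "(\<lambda>m \<in> carrier M. contraction (g (b \<odot>\<^bsub>M\<^esub> m))) \<in> module_homs A (restrict_scalars f M) N"
proof -
  have gc: "g m \<in> carrier E" if "m \<in> carrier M" for m
    using g that by (rule module_homs_closed)
  have g_add: "g (x \<oplus>\<^bsub>M\<^esub> y) = g x \<oplus>\<^bsub>E\<^esub> g y" if "x \<in> carrier M" "y \<in> carrier M" for x y
    using g that by (simp add: module_homs_def)
  have g_smult: "g (b \<odot>\<^bsub>M\<^esub> (f a \<odot>\<^bsub>M\<^esub> m)) = f a \<odot>\<^bsub>E\<^esub> g (b \<odot>\<^bsub>M\<^esub> m)"
    if "a \<in> carrier A" "m \<in> carrier M" for a m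
  proof -
    have "b \<odot>\<^bsub>M\<^esub> (f a \<odot>\<^bsub>M\<^esub> m) = f a \<odot>\<^bsub>M\<^esub> (b \<odot>\<^bsub>M\<^esub> m)"
      using that b by (simp add: M.smult_assoc1[symmetric] B.m_comm)
    then show ?thesis
      using g that b by (simp add: module_homs_def)
  qed
  show ?thesis
    unfolding module_homs_restrict_iff using b
    by (auto simp: M.smult_r_distr g_add g_smult gc contraction_add contraction_smult)
qed

lemma push_hom_closed:
  assumes "g \<in> module_homs B M E"
  shows "push_hom g \<in> module_homs A (restrict_scalars f M) N"
proof -
  have "push_hom g = (\<lambda>m \<in> carrier M. contraction (g (\<one>\<^bsub>B\<^esub> \<odot>\<^bsub>M\<^esub> m)))"
    by (auto simp: push_hom_def)
  then show ?thesis
    using component_hom[OF assms B.one_closed] by simp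
qed

lemma component_pull_hom:
  assumes "h \<in> module_homs A (restrict_scalars f M) N" "j \<in> I" "m \<in> carrier M"
  shows "contraction (d j \<odot>\<^bsub>E\<^esub> pull_hom h m) = h (d j \<odot>\<^bsub>M\<^esub> m)"
proof -
  have "(\<lambda>i. h (d i \<odot>\<^bsub>M\<^esub> m)) \<in> I \<rightarrow> carrier N"
    using assms by (auto simp: module_homs_restrict_iff)
  then show ?thesis
    using assms(2,3) by (simp add: pull_hom_def contraction_component)
qed

lemma pull_hom_in_carrier:
  assumes h: "h \<in> module_homs A (restrict_scalars f M) N" and m: "m \<in> carrier M"
  shows "pull_hom h m \<in> carrier E"
proof -
  have "h x \<in> carrier N" if "x \<in> carrier M" for x
    using h that by (auto simp: module_homs_restrict_iff)
  then show ?thesis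
    using m by (auto simp: pull_hom_def intro!: E.M.finsum_closed)
qed

text \<open>At coordinate \<open>j\<close> both sides equal \<open>h (d j r m)\<close>: the
  coefficients \<open>T (b e i)\<close> enter \<open>h\<close> by \<open>A\<close>-linearity and
  assemble the expansion of \<open>b = d j r\<close> in the basis \<open>d\<close>.\<close>

lemma pull_hom_smult:
  assumes h: "h \<in> module_homs A (restrict_scalars f M) N" and r: "r \<in> carrier B" and m: "m \<in> carrier M"
  shows "pull_hom h (r \<odot>\<^bsub>M\<^esub> m) = r \<odot>\<^bsub>E\<^esub> pull_hom h m"
proof (rule tensor_eqI)
  fix j assume j: "j \<in> I"
  define b where "b = d j \<otimes>\<^bsub>B\<^esub> r"
  have b: "b \<in> carrier B" using j r by (simp add: b_def)
  have hc: "h x \<in> carrier N" if "x \<in> carrier M" for x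
    using h that by (auto simp: module_homs_restrict_iff)
  have "contraction (d j \<odot>\<^bsub>E\<^esub> (r \<odot>\<^bsub>E\<^esub> pull_hom h m)) = contraction (b \<odot>\<^bsub>E\<^esub> pull_hom h m)"
    using j r pull_hom_in_carrier[OF h m] by (simp add: b_def E.smult_assoc1)
  also have "\<dots> = (\<Oplus>\<^bsub>N\<^esub>i\<in>I. T (b \<otimes>\<^bsub>B\<^esub> e i) \<odot>\<^bsub>N\<^esub> h (d i \<odot>\<^bsub>M\<^esub> m))"
    using b m hc by (simp add: pull_hom_def contraction_smult_expansion Pi_def)
  also have "\<dots> = (\<Oplus>\<^bsub>N\<^esub>i\<in>I. h ((f (T (b \<otimes>\<^bsub>B\<^esub> e i)) \<otimes>\<^bsub>B\<^esub> d i) \<odot>\<^bsub>M\<^esub> m))"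
    using b m hc h by (intro N.M.finsum_cong') (auto simp: module_homs_restrict_iff M.smult_assoc1)
  \<comment> \<open>The map \<open>c \<mapsto> h (c m)\<close> is additive in the ring element
    \<open>c\<close>, so the sum can be formed in \<open>B\<close> first.\<close>
  also have "\<dots> = h ((\<Oplus>\<^bsub>B\<^esub>i\<in>I. f (T (b \<otimes>\<^bsub>B\<^esub> e i)) \<otimes>\<^bsub>B\<^esub> d i) \<odot>\<^bsub>M\<^esub> m)"
    using b m hc h
    by (intro finsum_additive[where h = "\<lambda>c. h (c \<odot>\<^bsub>M\<^esub> m)", symmetric]
        B.is_abelian_group N.M.abelian_group_axioms)
      (auto simp: module_homs_restrict_iff M.smult_l_distr)
  also have "\<dots> = h (d j \<odot>\<^bsub>M\<^esub> (r \<odot>\<^bsub>M\<^esub> m))"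
    using j r m by (simp only: dual_basis_expansion[OF b]) (simp add: b_def M.smult_assoc1)
  also have "\<dots> = contraction (d j \<odot>\<^bsub>E\<^esub> pull_hom h (r \<odot>\<^bsub>M\<^esub> m))"
    using h j r m by (simp add: component_pull_hom)
  finally show "contraction (d j \<odot>\<^bsub>E\<^esub> pull_hom h (r \<odot>\<^bsub>M\<^esub> m)) =
    contraction (d j \<odot>\<^bsub>E\<^esub> (r \<odot>\<^bsub>E\<^esub> pull_hom h m))" by simp
qed (use assms pull_hom_in_carrier in auto)

lemma pull_hom_add:
  assumes h: "h \<in> module_homs A (restrict_scalars f M) N" and m: "m \<in> carrier M" "m' \<in> carrier M"
  shows "pull_hom h (m \<oplus>\<^bsub>M\<^esub> m') = pull_hom h m \<oplus>\<^bsub>E\<^esub> pull_hom h m'"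
proof (rule tensor_eqI)
  fix j assume "j \<in> I"
  then show "contraction (d j \<odot>\<^bsub>E\<^esub> pull_hom h (m \<oplus>\<^bsub>M\<^esub> m')) =
      contraction (d j \<odot>\<^bsub>E\<^esub> (pull_hom h m \<oplus>\<^bsub>E\<^esub> pull_hom h m'))"
    using m h component_pull_hom[OF h] pull_hom_in_carrier[OF h]
    by (simp add: E.smult_r_distr contraction_add M.smult_r_distr module_homs_restrict_iff)
qed (use assms pull_hom_in_carrier in auto)

lemma pull_hom_closed:
  assumes "h \<in> module_homs A (restrict_scalars f M) N"
  shows "pull_hom h \<in> module_homs B M E"
  using pull_hom_in_carrier[OF assms] pull_hom_smult[OF assms] pull_hom_add[OF assms]
  unfolding module_homs_def by (auto simp: pull_hom_def)

text \<open>The coordinate of \<open>pull_hom h m\<close> at \<open>t\<close> is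
  \<open>h (d t m)\<close>, which is \<open>h m\<close>.\<close>

lemma push_pull_hom:
  assumes h: "h \<in> module_homs A (restrict_scalars f M) N"
  shows "push_hom (pull_hom h) = h"
proof -
  have "contraction (pull_hom h m) = h m" if m: "m \<in> carrier M" for m
    using component_pull_hom[OF h t_in_I m] pull_hom_in_carrier[OF h m] m by (simp add: d_t)
  then show ?thesis
    using h by (auto simp: push_hom_def module_homs_restrict_iff PiE_iff extensional_def)
qed

text \<open>Linearity turns \<open>g (d i m)\<close> into \<open>d i\<close> times
  \<open>g m\<close>; what remains is the expansion of the tensor \<open>g m\<close>.\<close>

lemma hom_expansion:
  assumes g: "g \<in> module_homs B M E" and m: "m \<in> carrier M"
  shows "(\<Oplus>\<^bsub>E\<^esub>i\<in>I. tensor (e i) (contraction (g (d i \<odot>\<^bsub>M\<^esub> m)))) = g m"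
proof -
  have gm: "g m \<in> carrier E" using g m by (rule module_homs_closed)
  have "(\<Oplus>\<^bsub>E\<^esub>i\<in>I. tensor (e i) (contraction (g (d i \<odot>\<^bsub>M\<^esub> m)))) =
    (\<Oplus>\<^bsub>E\<^esub>i\<in>I. tensor (e i) (contraction (d i \<odot>\<^bsub>E\<^esub> g m)))"
    using g m gm by (intro E.M.finsum_cong') (auto simp: module_homs_def)
  then show ?thesis
    by (simp only: tensor_expansion[OF gm])
qed

lemma pull_push_hom:
  assumes g: "g \<in> module_homs B M E"
  shows "pull_hom (push_hom g) = g"
proof
  fix m
  show "pull_hom (push_hom g) m = g m"
  proof (cases "m \<in> carrier M")
    case True
    then have "pull_hom (push_hom g) m = (\<Oplus>\<^bsub>E\<^esub>i\<in>I. tensor (e i) (push_hom g (d i \<odot>\<^bsub>M\<^esub> m)))"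
      by (simp add: pull_hom_def)
    also have "\<dots> = (\<Oplus>\<^bsub>E\<^esub>i\<in>I. tensor (e i) (contraction (g (d i \<odot>\<^bsub>M\<^esub> m))))"
      using True module_homs_closed[OF g]
      by (intro E.M.finsum_cong') (auto simp: push_hom_def)
    finally show ?thesis
      by (simp add: hom_expansion[OF g True])
  next
    case False
    then show ?thesis
      using g by (auto simp: pull_hom_def module_homs_def PiE_iff extensional_def)
  qed
qed

text \<open>\<open>B\<close> acts through the target on one Hom module and through the source on the
  other; the two actions correspond because \<open>g\<close> is \<open>B\<close>-linear.\<close>

lemma push_hom_module_hom:
  "restrict push_hom (carrier (hom_module B M E)) \<in>
    module_homs B (hom_module B M E) (hom_from_restriction A f M N)"
proof -
  interpret H: module B "hom_module B M E"
    by (intro module_hom_module M.module_axioms E.module_axioms)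
  have "push_hom (g \<oplus>\<^bsub>hom_module B M E\<^esub> g') =
      push_hom g \<oplus>\<^bsub>hom_from_restriction A f M N\<^esub> push_hom g'"
    if "g \<in> module_homs B M E" "g' \<in> module_homs B M E" for g g'
    using that unfolding push_hom_def hom_module_def hom_from_restriction_def module_homs_def
    by (auto simp: contraction_add PiE_iff fun_eq_iff)
  moreover have "push_hom (r \<odot>\<^bsub>hom_module B M E\<^esub> g) =
      r \<odot>\<^bsub>hom_from_restriction A f M N\<^esub> push_hom g"
    if "r \<in> carrier B" "g \<in> module_homs B M E" for r g
    using that unfolding push_hom_def hom_module_def hom_from_restriction_def module_homs_def
    by (auto simp: fun_eq_iff)
  moreover have "carrier (hom_module B M E) = module_homs B M E"
    "carrier (hom_from_restriction A f M N) = module_homs A (restrict_scalars f M) N"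
    by (simp_all add: hom_module_def hom_from_restriction_def)
  ultimately show ?thesis
    using push_hom_closed H.M.a_closed H.smult_closed unfolding module_homs_def[of B "hom_module B M E"]
    by simp
qed

text \<open>Linearity of \<open>pull_hom\<close> as a map of Hom modules is inherited from its
  inverse \<open>push_hom\<close>.\<close>

lemma push_pull_isos:
  "restrict push_hom (carrier (hom_module B M E)) \<in>
    module_isos B (hom_module B M E) (hom_from_restriction A f M N)"
  "restrict pull_hom (carrier (hom_from_restriction A f M N)) \<in>
    module_isos B (hom_from_restriction A f M N) (hom_module B M E)"
proof -
  have c: "carrier (hom_module B M E) = module_homs B M E"
    "carrier (hom_from_restriction A f M N) = module_homs A (restrict_scalars f M) N"
    by (simp_all add: hom_module_def hom_from_restriction_def)
  note isos = module_isos_inverse[OF module_hom_module[OF M.module_axioms E.module_axioms]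
    push_hom_module_hom, of "restrict pull_hom (carrier (hom_from_restriction A f M N))"]
  show "restrict push_hom (carrier (hom_module B M E)) \<in>
      module_isos B (hom_module B M E) (hom_from_restriction A f M N)"
    by (rule isos(1)) (auto simp: c pull_hom_closed push_hom_closed push_pull_hom pull_push_hom)
  show "restrict pull_hom (carrier (hom_from_restriction A f M N)) \<in>
      module_isos B (hom_from_restriction A f M N) (hom_module B M E)"
    by (rule isos(2)) (auto simp: c pull_hom_closed push_hom_closed push_pull_hom pull_push_hom)
qed

text \<open>Existence and uniqueness in one equivalence: contraction against \<open>d i\<close>
  extracts the component \<open>c i\<close>, and conversely these contractions do expand
  \<open>g\<close>. Extensionality turns agreement on carriers into equality of families.\<close>

lemma expansion_unique:
  assumes g: "g \<in> module_homs B M E"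
  shows "c \<in> I \<rightarrow>\<^sub>E module_homs A (restrict_scalars f M) N \<and>
      (\<forall>m \<in> carrier M. g m = (\<Oplus>\<^bsub>E\<^esub>i\<in>I. tensor (e i) (c i m))) \<longleftrightarrow>
    c = (\<lambda>i \<in> I. \<lambda>m \<in> carrier M. contraction (g (d i \<odot>\<^bsub>M\<^esub> m)))" (is "?L \<longleftrightarrow> c = ?c")
proof
  assume L: ?L
  then have c: "c i \<in> module_homs A (restrict_scalars f M) N" if "i \<in> I" for i
    using that by blast
  have "c i m = ?c i m" if i: "i \<in> I" and m: "m \<in> carrier M" for i m
  proof -
    have "c j m \<in> carrier N" if "j \<in> I" for j
      using c[OF that] m by (auto simp: module_homs_restrict_iff)
    then have "(\<lambda>i. c i m) \<in> I \<rightarrow> carrier N"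
      by blast
    then have "contraction (d i \<odot>\<^bsub>E\<^esub> g m) = c i m"
      using L m contraction_component[OF i] by simp
    then show ?thesis
      using g i m by (simp add: module_homs_def)
  qed
  then have "c i = ?c i" if "i \<in> I" for i
    using c[OF that] that by (auto simp: module_homs_restrict_iff PiE_iff extensional_def fun_eq_iff)
  then show "c = ?c"
    using L by (auto simp: PiE_iff extensional_def fun_eq_iff)
next
  assume "c = ?c"
  moreover have "?c \<in> I \<rightarrow>\<^sub>E module_homs A (restrict_scalars f M) N"
    using component_hom[OF g] by auto
  moreover have "g m = (\<Oplus>\<^bsub>E\<^esub>i\<in>I. tensor (e i) (?c i m))" if m: "m \<in> carrier M" for m
  proof -
    have "(\<Oplus>\<^bsub>E\<^esub>i\<in>I. tensor (e i) (?c i m)) =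
      (\<Oplus>\<^bsub>E\<^esub>i\<in>I. tensor (e i) (contraction (g (d i \<odot>\<^bsub>M\<^esub> m))))"
      using m module_homs_closed[OF g] by (intro E.M.finsum_cong') auto
    then show ?thesis
      by (simp only: hom_expansion[OF g m])
  qed
  ultimately show ?L
    by blast
qed

end


section \<open>Polynomials over a perfect field\<close>

text \<open>Natural numbers are constant polynomials. This makes the freshman's dream available for
  polynomials.\<close>

lemma CHAR_poly_mapping:
  "CHAR('a::comm_monoid_add \<Rightarrow>\<^sub>0 'k::comm_semiring_1) = CHAR('k)"
proof (rule CHAR_eqI)
  show "of_nat CHAR('k) = (0 :: 'a \<Rightarrow>\<^sub>0 'k)"
    by (simp flip: single_of_nat)
next
  fix x assume "of_nat x = (0 :: 'a \<Rightarrow>\<^sub>0 'k)"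
  then have "Poly_Mapping.single (0::'a) (of_nat x :: 'k) = 0"
    by simp
  then have "of_nat x = (0 :: 'k)"
    by (metis lookup_single_eq lookup_zero)
  then show "CHAR('k) dvd x"
    by (simp add: of_nat_eq_0_iff_char_dvd)
qed

text \<open>A polynomial is the sum of its terms; the set \<open>S\<close> confines these to the
  exponents allowed in \<open>n\<close> variables.\<close>

lemma poly_mapping_single_induct [consumes 1, case_names zero single add]:
  fixes f :: "'a \<Rightarrow>\<^sub>0 'b::comm_monoid_add"
  assumes "Poly_Mapping.keys f \<subseteq> S"
    and "P 0" and single: "\<And>m c. m \<in> S \<Longrightarrow> P (Poly_Mapping.single m c)"
    and add: "\<And>g h. P g \<Longrightarrow> P h \<Longrightarrow> P (g + h)"
  shows "P f"
proof -
  have "P (\<Sum>m\<in>F. Poly_Mapping.single m (Poly_Mapping.lookup f m))" if "F \<subseteq> S" for F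
    using that by (induction F rule: infinite_finite_induct) (auto simp: assms(2) single add)
  moreover have "f = (\<Sum>m\<in>Poly_Mapping.keys f. Poly_Mapping.single m (Poly_Mapping.lookup f m))"
    by (rule poly_mapping_eqI) (simp add: lookup_sum lookup_single when_def in_keys_iff)
  ultimately show ?thesis
    using assms(1) by metis
qed

definition scale_exponent :: "nat \<Rightarrow> (nat \<Rightarrow>\<^sub>0 nat) \<Rightarrow> (nat \<Rightarrow>\<^sub>0 nat)" where
  "scale_exponent q m = Poly_Mapping.map ((*) q) m"

lemma lookup_scale_exponent [simp]:
  "Poly_Mapping.lookup (scale_exponent q m) l = q * Poly_Mapping.lookup m l"
  by (simp add: scale_exponent_def Poly_Mapping.map.rep_eq when_def)

lemma scale_exponent_add: "scale_exponent q (m + m') = scale_exponent q m + scale_exponent q m'"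
  by (rule poly_mapping_eqI) (simp add: lookup_add algebra_simps)

lemma single_power:
  "Poly_Mapping.single m (c :: 'k::comm_semiring_1) ^ q = Poly_Mapping.single (scale_exponent q m) (c ^ q)"
proof (induction q)
  case 0
  have "scale_exponent 0 m = 0"
    by (rule poly_mapping_eqI) simp
  then show ?case by simp
next
  case (Suc q)
  have "m + scale_exponent q m = scale_exponent (Suc q) m"
    by (rule poly_mapping_eqI) (simp add: lookup_add)
  then show ?case by (simp add: Suc mult_single)
qed

definition exponent :: "nat \<Rightarrow> (nat \<Rightarrow> nat) \<Rightarrow> (nat \<Rightarrow>\<^sub>0 nat)" where
  "exponent n i = (\<Sum>j<n. Poly_Mapping.single j (i j))"

lemma lookup_exponent: "Poly_Mapping.lookup (exponent n i) l = (if l < n then i l else 0)"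
  by (simp add: exponent_def lookup_sum lookup_single when_def)

lemma monomial_basis_eq_single: "monomial_basis n i = Poly_Mapping.single (exponent n i) (1 :: 'k::field)"
proof -
  have "mpoly_var j ^ q = Poly_Mapping.single (Poly_Mapping.single j q) (1 :: 'k)" for j q
    by (induction q) (auto simp: mpoly_var_def mult_single simp flip: single_add)
  then show ?thesis
    unfolding monomial_basis_def exponent_def
    by (induction n) (auto simp: mult_single)
qed

lemma mult_mpoly_ring [simp]: "f \<otimes>\<^bsub>mpoly_ring n\<^esub> g = f * g"
  and add_mpoly_ring [simp]: "f \<oplus>\<^bsub>mpoly_ring n\<^esub> g = f + g"
  and one_mpoly_ring [simp]: "\<one>\<^bsub>mpoly_ring n\<^esub> = 1"
  and zero_mpoly_ring [simp]: "\<zero>\<^bsub>mpoly_ring n\<^esub> = 0"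
  by (simp_all add: mpoly_ring_def)

lemma carrier_mpoly_ring_iff:
  "f \<in> carrier (mpoly_ring n) \<longleftrightarrow> Poly_Mapping.keys f \<subseteq> {m. Poly_Mapping.keys m \<subseteq> {..<n}}"
  by (auto simp: mpoly_ring_def)

lemma finsum_mpoly_ring:
  fixes g :: "'i \<Rightarrow> 'k::field mpoly"
  assumes "finite I" "g \<in> I \<rightarrow> carrier (mpoly_ring n)"
  shows "(\<Oplus>\<^bsub>mpoly_ring n\<^esub>i\<in>I. g i) = (\<Sum>i\<in>I. g i)"
proof -
  interpret cring "mpoly_ring n :: 'k mpoly ring" by (rule cring_mpoly_ring)
  show ?thesis
    using assms
  proof (induction I)
    case empty
    show ?case using finsum_empty[where f = g] by simp
  next
    case (insert i I)
    then show ?case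
      using finsum_insert[of I i g] by (simp add: Pi_def)
  qed
qed

lemma frobenius_mpoly_ring [simp]: "frobenius p (mpoly_ring n) f = f ^ p"
proof -
  have "f [^]\<^bsub>mpoly_ring n\<^esub> p = f ^ p"
    by (induction p) (simp_all add: Group.nat_pow_def mult.commute)
  then show ?thesis by (simp add: frobenius_def)
qed

lemma finite_multi_indices: "finite (multi_indices p n)"
  unfolding multi_indices_def by (intro finite_PiE) auto

lemma multi_indices_less: "i \<in> multi_indices p n \<Longrightarrow> l < n \<Longrightarrow> i l < p"
  by (auto simp: multi_indices_def PiE_iff)

lemma top_index_in_multi_indices: "p > 0 \<Longrightarrow> top_index p n \<in> multi_indices p n"
  by (auto simp: multi_indices_def top_index_def)

lemma exponent_complement_index:
  assumes "i \<in> multi_indices p n"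
  shows "exponent n (complement_index p n i) + exponent n i = exponent n (top_index p n)"
proof (rule poly_mapping_eqI)
  fix l
  show "Poly_Mapping.lookup (exponent n (complement_index p n i) + exponent n i) l =
      Poly_Mapping.lookup (exponent n (top_index p n)) l"
    using multi_indices_less[OF assms, of l]
    by (auto simp: lookup_add lookup_exponent complement_index_def top_index_def)
qed

text \<open>Division with remainder by \<open>p\<close> in each coordinate; beyond the first
  \<open>n\<close> coordinates quotient and remainder are zero because \<open>s\<close> is.\<close>

lemma exponent_division:
  assumes "p > 0" "Poly_Mapping.keys s \<subseteq> {..<n}"
  obtains m i where "i \<in> multi_indices p n" "s = scale_exponent p m + exponent n i"
proof
  show "(\<lambda>j\<in>{..<n}. Poly_Mapping.lookup s j mod p) \<in> multi_indices p n"
    using assms(1) by (auto simp: multi_indices_def)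
  show "s = scale_exponent p (Poly_Mapping.map (\<lambda>a. a div p) s) +
      exponent n (\<lambda>j\<in>{..<n}. Poly_Mapping.lookup s j mod p)"
  proof (rule poly_mapping_eqI)
    fix l
    have "Poly_Mapping.lookup s l = 0" if "\<not> l < n"
      using assms(2) that by (meson in_keys_iff lessThan_iff subsetD)
    then show "Poly_Mapping.lookup s l = Poly_Mapping.lookup (scale_exponent p (Poly_Mapping.map (\<lambda>a. a div p) s) +
        exponent n (\<lambda>j\<in>{..<n}. Poly_Mapping.lookup s j mod p)) l"
      by (simp add: lookup_add lookup_exponent Poly_Mapping.map.rep_eq when_def)
  qed
qed

text \<open>Below \<open>n\<close> the entries are remainders modulo \<open>p\<close>; elsewhere
  multi-indices agree by extensionality.\<close>

lemma exponent_division_unique: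
  assumes "i \<in> multi_indices p n" "i' \<in> multi_indices p n"
    and "scale_exponent p m + exponent n i = scale_exponent p m' + exponent n i'"
  shows "i = i'"
proof -
  have "i l = i' l" if l: "l < n" for l
  proof -
    have "p * Poly_Mapping.lookup m l + i l = p * Poly_Mapping.lookup m' l + i' l"
      using arg_cong[OF assms(3), of "\<lambda>s. Poly_Mapping.lookup s l"] l
      by (simp add: lookup_add lookup_exponent)
    then have "(p * Poly_Mapping.lookup m l + i l) mod p = (p * Poly_Mapping.lookup m' l + i' l) mod p"
      by simp
    then show ?thesis
      using multi_indices_less[OF assms(1) l] multi_indices_less[OF assms(2) l] by simp
  qed
  then show ?thesis
    using assms(1,2) unfolding multi_indices_def by (intro PiE_ext) auto
qed

section \<open>The inverse Frobenius of a perfect field\<close>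

text \<open>Perfectness in the case of positive characteristic. The argument \<open>K\<close> ties
  the coefficient type to the locale parameters.\<close>

locale perfect_char =
  fixes p n :: nat and K :: "'k::field itself"
  assumes CHAR_eq: "CHAR('k) = p" and p_pos: "p > 0" and surj_power: "surj (\<lambda>a::'k. a ^ p)"
begin

lemma prime_p: "prime p"
  using prime_CHAR_semidom[where 'a = 'k] CHAR_eq p_pos by simp

lemma power_p_add: "(a + b) ^ p = a ^ p + (b :: 'k) ^ p"
  using prime_p by (intro freshmans_dream) (simp_all add: CHAR_eq)

lemma mpoly_power_p_add: "(f + g) ^ p = f ^ p + (g :: 'k mpoly) ^ p"
  using prime_p by (intro freshmans_dream) (simp_all add: CHAR_eq CHAR_poly_mapping)

text \<open>The \<open>p\<close>-th power map is additive, and a field has no nonzero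
  nilpotents.\<close>

lemma inj_power: "inj (\<lambda>a::'k. a ^ p)"
proof (rule injI)
  fix a b :: 'k assume "a ^ p = b ^ p"
  then have "(a - b) ^ p = 0"
    using power_p_add[of "a - b" b] by simp
  then show "a = b" by simp
qed

definition pth_root :: "'k \<Rightarrow> 'k" where
  "pth_root = inv_into UNIV (\<lambda>a. a ^ p)"

lemma pth_root_power [simp]: "pth_root c ^ p = c"
  unfolding pth_root_def by (rule surj_f_inv_f[OF surj_power])

lemma pth_root_eqI: "a ^ p = c \<Longrightarrow> pth_root c = a"
  using injD[OF inj_power, of "pth_root c" a] by simp

lemma pth_root_0 [simp]: "pth_root 0 = 0"
  using p_pos by (intro pth_root_eqI) simp

lemma pth_root_1 [simp]: "pth_root 1 = 1"
  by (intro pth_root_eqI) simp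

lemma pth_root_add: "pth_root (a + b) = pth_root a + pth_root b"
  by (intro pth_root_eqI) (simp add: power_p_add)

lemma pth_root_mult_power: "pth_root (a ^ p * b) = a * pth_root b"
  by (intro pth_root_eqI) (simp add: power_mult_distrib)

section \<open>The top coefficient and the dual basis of monomials\<close>

abbreviation "top_exponent \<equiv> exponent n (top_index p n)"

text \<open>The coefficient of a polynomial at the top basis monomial.\<close>

definition Frob_trace :: "'k mpoly \<Rightarrow> 'k mpoly" where
  "Frob_trace f = Poly_Mapping.map pth_root (Poly_Mapping.map_key (\<lambda>m. scale_exponent p m + top_exponent) f)"

lemma scale_exponent_eq_iff [simp]: "scale_exponent p m = scale_exponent p m' \<longleftrightarrow> m = m'"
  using p_pos by (auto simp: poly_mapping_eq_iff fun_eq_iff)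

lemma lookup_Frob_trace:
  "Poly_Mapping.lookup (Frob_trace f) m =
    pth_root (Poly_Mapping.lookup f (scale_exponent p m + top_exponent))"
proof -
  \<comment> \<open>\<open>map_key\<close> composes with the change of exponents when that change is
    injective; \<open>Poly_Mapping.map\<close> keeps zero coefficients at zero, in accordance with
    \<open>pth_root 0 = 0\<close>.\<close>
  have "inj (\<lambda>m. scale_exponent p m + top_exponent)"
    by (rule injI) simp
  then show ?thesis
    by (simp add: Frob_trace_def Poly_Mapping.map.rep_eq map_key.rep_eq when_def)
qed

lemma Frob_trace_0 [simp]: "Frob_trace 0 = 0"
  by (rule poly_mapping_eqI) (simp add: lookup_Frob_trace)

lemma Frob_trace_add: "Frob_trace (f + g) = Frob_trace f + Frob_trace g"
  by (rule poly_mapping_eqI) (simp add: lookup_Frob_trace lookup_add pth_root_add)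

lemma Frob_trace_single:
  "Frob_trace (Poly_Mapping.single (scale_exponent p m + top_exponent) c) = Poly_Mapping.single m (pth_root c)"
  by (rule poly_mapping_eqI) (auto simp: lookup_Frob_trace lookup_single when_def)

lemma Frob_trace_single_eq_0:
  "(\<And>m. s \<noteq> scale_exponent p m + top_exponent) \<Longrightarrow> Frob_trace (Poly_Mapping.single s c) = 0"
  by (rule poly_mapping_eqI) (auto simp: lookup_Frob_trace lookup_single when_def)

text \<open>An exponent \<open>m\<close> of the trace comes from the exponent
  \<open>p m + top_exponent\<close> of \<open>f\<close>, which involves every variable of
  \<open>m\<close> because \<open>p\<close> is positive.\<close>

lemma Frob_trace_closed:
  assumes "f \<in> carrier (mpoly_ring n)"
  shows "Frob_trace f \<in> carrier (mpoly_ring n)"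
proof -
  have "l < n" if m: "m \<in> Poly_Mapping.keys (Frob_trace f)" and l: "l \<in> Poly_Mapping.keys m" for m l
  proof -
    have "scale_exponent p m + top_exponent \<in> Poly_Mapping.keys f"
      using m by (auto simp: in_keys_iff lookup_Frob_trace)
    then have "Poly_Mapping.keys (scale_exponent p m + top_exponent) \<subseteq> {..<n}"
      using assms by (auto simp: carrier_mpoly_ring_iff)
    moreover have "l \<in> Poly_Mapping.keys (scale_exponent p m + top_exponent)"
      using l p_pos by (simp add: in_keys_iff lookup_add)
    ultimately show ?thesis by auto
  qed
  then show ?thesis by (auto simp: carrier_mpoly_ring_iff)
qed

text \<open>All entries of \<open>top_exponent\<close> are below \<open>p\<close>, so
  \<open>p m \<le> p k + top_exponent\<close> forces \<open>m \<le> k\<close> in each coordinate,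
  and the truncated difference \<open>k - m\<close> is exact.\<close>

lemma top_exponent_shift:
  assumes "scale_exponent p m + s = scale_exponent p k + top_exponent"
  shows "s = scale_exponent p (k - m) + top_exponent"
proof (rule poly_mapping_eqI)
  fix l
  let ?m = "Poly_Mapping.lookup m l" and ?k = "Poly_Mapping.lookup k l"
  let ?t = "Poly_Mapping.lookup top_exponent l"
  have eq: "p * ?m + Poly_Mapping.lookup s l = p * ?k + ?t"
    using arg_cong[OF assms, of "\<lambda>s. Poly_Mapping.lookup s l"] by (simp add: lookup_add)
  have "?t < p"
    using p_pos by (simp add: lookup_exponent top_index_def)
  then have "p * ?m < p * Suc ?k"
    using eq by simp
  then have "?m \<le> ?k"
    by (simp only: nat_mult_less_cancel1[OF p_pos] less_Suc_eq_le)
  then have "p * ?k = p * ?m + p * (?k - ?m)"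
    by (simp flip: distrib_left)
  then show "Poly_Mapping.lookup s l = Poly_Mapping.lookup (scale_exponent p (k - m) + top_exponent) l"
    using eq by (simp add: lookup_add lookup_minus)
qed

text \<open>Both sides are additive in \<open>f\<close> and in \<open>g\<close>, so single terms
  suffice. If the exponent of \<open>g\<close> has the form \<open>p k + top_exponent\<close>, the
  formula is computed; otherwise the product has no such exponent either, by
  \<open>top_exponent_shift\<close>, and both sides vanish.\<close>

lemma Frob_trace_mult_power: "Frob_trace (f ^ p * g) = f * Frob_trace g"
  using subset_UNIV[of "Poly_Mapping.keys f"]
proof (induction f rule: poly_mapping_single_induct)
  case zero
  then show ?case using p_pos by (simp add: zero_power)
next
  case (single m a)
  show ?case
    using subset_UNIV[of "Poly_Mapping.keys g"]
  proof (induction g rule: poly_mapping_single_induct)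
    case (single s c)
    show ?case
    proof (cases "\<exists>k. s = scale_exponent p k + top_exponent")
      case True
      then obtain k where k: "s = scale_exponent p k + top_exponent" by blast
      then have "scale_exponent p m + s = scale_exponent p (m + k) + top_exponent"
        by (simp add: scale_exponent_add add.assoc)
      then show ?thesis
        by (simp add: single_power mult_single Frob_trace_single pth_root_mult_power) (simp add: k Frob_trace_single mult_single)
    next
      case False
      then show ?thesis
        using top_exponent_shift[of m s]
        by (metis Frob_trace_single_eq_0 mult_single mult_zero_right single_power)
    qed
  qed (simp_all add: distrib_left Frob_trace_add)
qed (simp add: distrib_right mpoly_power_p_add Frob_trace_add)

text \<open>The complementary monomial raises the remainder \<open>i\<close> exactly to the top
  exponent.\<close>

lemma Frob_trace_complement:
  assumes "i \<in> multi_indices p n"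
  shows "Frob_trace (monomial_basis n (complement_index p n i) *
    Poly_Mapping.single (scale_exponent p m + exponent n i) c) = Poly_Mapping.single m (pth_root c)"
proof -
  have "exponent n (complement_index p n i) + (scale_exponent p m + exponent n i) =
      scale_exponent p m + top_exponent"
    by (simp add: exponent_complement_index[OF assms, symmetric] add_ac)
  then show ?thesis
    by (simp add: monomial_basis_eq_single mult_single Frob_trace_single)
qed

text \<open>If the product had an exponent seen by the trace, cancelling the complement of
  \<open>i\<close> would make \<open>i\<close> and \<open>j\<close> remainders of one
  exponent.\<close>

lemma Frob_trace_complement_eq_0:
  assumes i: "i \<in> multi_indices p n" and j: "j \<in> multi_indices p n" and "i \<noteq> j"
  shows "Frob_trace (monomial_basis n (complement_index p n i) *
    Poly_Mapping.single (scale_exponent p m + exponent n j) c) = 0"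
proof -
  have "exponent n (complement_index p n i) + (scale_exponent p m + exponent n j) \<noteq>
      scale_exponent p k + top_exponent" for k
  proof
    assume "exponent n (complement_index p n i) + (scale_exponent p m + exponent n j) =
      scale_exponent p k + top_exponent"
    then have "exponent n (complement_index p n i) + (scale_exponent p m + exponent n j) =
        exponent n (complement_index p n i) + (scale_exponent p k + exponent n i)"
      by (simp add: exponent_complement_index[OF i, symmetric] add_ac)
    then have "scale_exponent p m + exponent n j = scale_exponent p k + exponent n i"
      by (rule add_left_imp_eq)
    then show False
      using exponent_division_unique[OF j i] \<open>i \<noteq> j\<close> by blast
  qed
  then show ?thesis
    by (simp add: monomial_basis_eq_single mult_single Frob_trace_single_eq_0)
qed

text \<open>By additivity a single term with exponent \<open>p m + exponent n j\<close> suffices.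
  Only \<open>i = j\<close> contributes, and the \<open>p\<close>-th power undoes the root of the
  coefficient.\<close>

lemma monomial_basis_expansion:
  assumes "f \<in> carrier (mpoly_ring n)"
  shows "(\<Sum>i\<in>multi_indices p n.
    Frob_trace (monomial_basis n (complement_index p n i) * f) ^ p * monomial_basis n i) = f"
  using assms[unfolded carrier_mpoly_ring_iff]
proof (induction rule: poly_mapping_single_induct)
  case zero
  then show ?case using p_pos by (simp add: zero_power)
next
  case (single s c)
  then obtain m j where j: "j \<in> multi_indices p n" and s: "s = scale_exponent p m + exponent n j"
    using exponent_division[OF p_pos] by blast
  have "(\<Sum>i\<in>multi_indices p n.
      Frob_trace (monomial_basis n (complement_index p n i) * Poly_Mapping.single s c) ^ p * monomial_basis n i) =
    (\<Sum>i\<in>multi_indices p n. if i = j then Poly_Mapping.single s c else 0)"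
    using p_pos j by (intro sum.cong)
      (auto simp: s Frob_trace_complement Frob_trace_complement_eq_0 single_power monomial_basis_eq_single[of n j] mult_single)
  then show ?case
    using j by (simp add: finite_multi_indices)
next
  case (add f g)
  then show ?case
    by (simp add: distrib_left distrib_right Frob_trace_add mpoly_power_p_add sum.distrib)
qed

lemma monomial_basis_closed: "monomial_basis n i \<in> carrier (mpoly_ring n)"
  by (auto simp: monomial_basis_eq_single carrier_mpoly_ring_iff in_keys_iff lookup_exponent split: if_splits)

lemma Frob_trace_dual_basis:
  assumes "i \<in> multi_indices p n" "j \<in> multi_indices p n"
  shows "Frob_trace (monomial_basis n (complement_index p n i) * monomial_basis n j) = (if i = j then 1 else 0)"
proof -
  have "scale_exponent p 0 = 0"
    by (rule poly_mapping_eqI) simp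
  then show ?thesis
    using Frob_trace_complement[OF assms(1), of 0 1] Frob_trace_complement_eq_0[OF assms, of 0 1]
    by (cases "i = j") (simp_all add: monomial_basis_eq_single[of n j])
qed

lemma frobenius_extension_mpoly_ring:
  fixes M :: "('k mpoly, 'm) module" and N :: "('k mpoly, 'n) module"
  assumes M: "Module.module (mpoly_ring n) M" and N: "Module.module (mpoly_ring n) N"
  shows "frobenius_extension (mpoly_ring n) (mpoly_ring n) N (frobenius p (mpoly_ring n)) M
    Frob_trace (multi_indices p n) (monomial_basis n) (\<lambda>i. monomial_basis n (complement_index p n i))
    (top_index p n)"
proof -
  interpret R: cring "mpoly_ring n :: 'k mpoly ring" by (rule cring_mpoly_ring)
  have closed: "f * g \<in> carrier (mpoly_ring n)" "f ^ p \<in> carrier (mpoly_ring n)"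
    if "f \<in> carrier (mpoly_ring n)" "g \<in> carrier (mpoly_ring n)" for f g :: "'k mpoly"
    using R.m_closed[OF that] R.nat_pow_closed[OF that(1), of p] frobenius_mpoly_ring[of p n f]
    by (simp_all add: frobenius_def)
  \<comment> \<open>The complement of the top index is zero, so the top index can serve as the
    distinguished index \<open>t\<close>.\<close>
  have "monomial_basis n (complement_index p n (top_index p n)) = (1 :: 'k mpoly)"
  proof -
    have "exponent n (complement_index p n (top_index p n)) = 0"
      by (rule poly_mapping_eqI) (simp add: lookup_exponent complement_index_def top_index_def)
    then show ?thesis by (simp add: monomial_basis_eq_single)
  qed
  then show ?thesis
    using frobenius_closed[OF R.is_cring, of p]
    by (intro frobenius_extension.intro scalar_extension.intro scalar_extension_axioms.intro
        frobenius_extension_axioms.intro R.is_cring M N)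
      (auto simp: Frob_trace_closed Frob_trace_add Frob_trace_mult_power finite_multi_indices
        monomial_basis_closed finsum_mpoly_ring closed monomial_basis_expansion
        Frob_trace_dual_basis top_index_in_multi_indices p_pos Pi_def)
qed

end

section \<open>The isomorphism for the Frobenius map of a polynomial ring\<close>

theorem theorem3p3:
  fixes p n :: nat
    and M :: "('k::field mpoly, 'm) module"
    and N :: "('k mpoly, 'n) module"
  assumes "perfect_field TYPE('k)" and "CHAR('k) = p" and "p > 0"
    and "Module.module (mpoly_ring n) M"
    and "Module.module (mpoly_ring n) N"
  shows "(\<forall>g \<in> carrier (Hom_pull p n M N). \<exists>!c. is_expansion p n M N g c) \<and>
    push_to_pull p n M N \<in> module_isos (mpoly_ring n) (Hom_push p n M N) (Hom_pull p n M N) \<and>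
    pull_to_push p n M N \<in> module_isos (mpoly_ring n) (Hom_pull p n M N) (Hom_push p n M N) \<and>
    (\<forall>g \<in> carrier (Hom_push p n M N). pull_to_push p n M N (push_to_pull p n M N g) = g) \<and>
    (\<forall>g \<in> carrier (Hom_pull p n M N). push_to_pull p n M N (pull_to_push p n M N g) = g)"
proof -
  interpret P: perfect_char p n "TYPE('k)"
    using assms by unfold_locales (auto simp: perfect_field_def)
  interpret F: frobenius_extension "mpoly_ring n" "mpoly_ring n" N "frobenius p (mpoly_ring n)" M
    P.Frob_trace "multi_indices p n" "monomial_basis n"
    "\<lambda>i. monomial_basis n (complement_index p n i)" "top_index p n"
    by (rule P.frobenius_extension_mpoly_ring[OF assms(4,5)])
  have carrier_pull: "carrier (Hom_pull p n M N) = module_homs (mpoly_ring n) M F.E"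
    by (simp add: Hom_pull_def hom_module_def Frob_pull_def)
  have carrier_push: "carrier (Hom_push p n M N) =
      module_homs (mpoly_ring n) (restrict_scalars (frobenius p (mpoly_ring n)) M) N"
    by (simp add: Hom_push_def hom_from_restriction_def)
  \<comment> \<open>An explicit description of the only expansion; it yields unique existence and
    evaluates the \<open>THE\<close> in \<open>pull_to_push\<close>.\<close>
  have expansion_iff: "is_expansion p n M N g c \<longleftrightarrow>
      c = (\<lambda>i \<in> multi_indices p n. \<lambda>m \<in> carrier M.
        F.contraction (g (monomial_basis n (complement_index p n i) \<odot>\<^bsub>M\<^esub> m)))"
    if "g \<in> carrier (Hom_pull p n M N)" for g c
    unfolding is_expansion_def Frob_push_def Frob_pull_def Frob_tensor_def
    using that unfolding carrier_pull by (rule F.expansion_unique)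
  have push_to_pull: "push_to_pull p n M N = restrict F.pull_hom (carrier (Hom_push p n M N))"
    by (simp add: push_to_pull_def F.pull_hom_def[abs_def] Frob_pull_def Frob_tensor_def)
  have pull_to_push: "pull_to_push p n M N = restrict F.push_hom (carrier (Hom_pull p n M N))"
    unfolding pull_to_push_def
  proof (rule restrict_ext)
    fix g assume g: "g \<in> carrier (Hom_pull p n M N)"
    \<comment> \<open>The component at the top index contracts \<open>g\<close> after multiplication
      by \<open>d t\<close>, which is one, so it coincides with \<open>F.push_hom g\<close>.\<close>
    have "F.push_hom g = (\<lambda>m \<in> carrier M.
        F.contraction (g (monomial_basis n (complement_index p n (top_index p n)) \<odot>\<^bsub>M\<^esub> m)))"
      using F.M.smult_one F.d_t unfolding F.push_hom_def by (intro restrict_ext) simp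
    then show "(THE c. is_expansion p n M N g c) (top_index p n) = F.push_hom g"
      by (simp add: expansion_iff[OF g] F.t_in_I)
  qed
  have "\<exists>!c. is_expansion p n M N g c" if "g \<in> carrier (Hom_pull p n M N)" for g
    by (simp add: expansion_iff[OF that])
  moreover have "push_to_pull p n M N \<in> module_isos (mpoly_ring n) (Hom_push p n M N) (Hom_pull p n M N)"
    "pull_to_push p n M N \<in> module_isos (mpoly_ring n) (Hom_pull p n M N) (Hom_push p n M N)"
    using F.push_pull_isos unfolding push_to_pull pull_to_push
    by (simp_all add: Hom_pull_def Hom_push_def Frob_pull_def)
  ultimately show ?thesis
    using F.push_hom_closed F.pull_hom_closed F.push_pull_hom F.pull_push_hom
    by (simp add: push_to_pull pull_to_push carrier_pull carrier_push)
qed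

end
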